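(* Given a TRS and an assignment $(\!|-|\!)\in\mathsf{MaxPlus}^{(\mathsf{k},\mathsf{d})}\{\mathbb{R}^+\}$, one can check in time polynomial in $\mathsf{d}$ and $\mathsf{k}$ whether $(\!|-|\!)$ is a quasi-interpretation of the TRS.
   Context: A constructor TRS consists of disjoint sets $\mathcal{C}$ (constructors) and $\mathcal{D}$ (defined symbols) with fixed arities, variables, and finitely many rules $l\to r$ with $l=\mathtt{f}(t_1,\dots,t_n)$, $\mathtt{f}\in\mathcal{D}$, $t_i$ built from constructors and variables, variables of $r$ occurring in $l$; throughout, TRS are orthogonal constructor TRS. $\mathsf{MaxPlus}\{\mathbb{R}^+\}$ is the set of functions $Q(X_1,\dots,X_n)=\max_{1\le i\le m}(\sum_{j=1}^n\alpha_{i,j}X_j+\alpha_{i,0})$ with $\alpha_{i,j}\in\mathbb{R}^+$ (nonnegative reals) and variables over $\mathbb{R}^+$. For $Q$ in this normal form, its $+$-degree is $\max_{i,\,j\in[0,n]}\alpha_{i,j}$ and its $\max$-degree is $m$. $\mathsf{MaxPlus}^{(\mathsf{k},\mathsf{d})}\{\mathbb{R}^+\}$ is the set of such functions with $+$-degree at most $\mathsf{d}$ and $\max$-degree at most $\mathsf{k}$. An assignment maps each symbol to a $\mathsf{MaxPlus}\{\mathbb{R}^+\}$ function and is extended homomorphically to terms; it is in $\mathsf{MaxPlus}^{(\mathsf{k},\mathsf{d})}\{\mathbb{R}^+\}$ if for every rule $l\to r$ both $(\!|l|\!)$ and $(\!|r|\!)$ (as functions of the rule's variables) belong to $\mathsf{MaxPlus}^{(\mathsf{k},\mathsf{d})}\{\mathbb{R}^+\}$.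 A quasi-interpretation is an assignment whose functions are nondecreasing in each argument, with $(\!|l|\!)\geq(\!|r|\!)$ for every rule (for all variable values) and $(\!|\mathtt{g}|\!)(X_1,\dots,X_m)\geq X_i$ for every symbol $\mathtt{g}$ of arity $m$ and every $i$.
   Formalization: The assignment is given by normal forms with at most k rows for every symbol, not only for the rule sides: with the sole rule f(c)→c both sides are constants (k=1), yet f may have arbitrarily many rows that must all be read to test f(X)≥X. *)

theory Defs
  imports Complex_Main "HOL-Computational_Algebra.Polynomial"
begin

section \<open>Orthogonal constructor term rewriting systems\<close>

datatype trm = Var nat | Fun nat "trm list"

fun var_occs :: "trm \<Rightarrow> nat list" where
  "var_occs (Var x) = [x]"
| "var_occs (Fun f ts) = concat (map var_occs ts)"

definition vars :: "trm \<Rightarrow> nat set" where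
  "vars t = set (var_occs t)"

fun subterms :: "trm \<Rightarrow> trm set" where
  "subterms (Var x) = {Var x}"
| "subterms (Fun f ts) = insert (Fun f ts) (\<Union>t\<in>set ts. subterms t)"

fun subst :: "(nat \<Rightarrow> trm) \<Rightarrow> trm \<Rightarrow> trm" where
  "subst \<sigma> (Var x) = \<sigma> x"
| "subst \<sigma> (Fun f ts) = Fun f (map (subst \<sigma>) ts)"

text \<open>A signature is a list of pairs (symbol, arity).  Lists are used instead of sets because
  a system is also the input of an algorithm.\<close>

type_synonym signature = "(nat \<times> nat) list"

record trs =
  constructors :: signature
  defined_syms :: signature
  rules :: "(trm \<times> trm) list"

definition symbols :: "trs \<Rightarrow> signature" where
  "symbols R = constructors R @ defined_syms R"

fun wf_term :: "signature \<Rightarrow> trm \<Rightarrow> bool" where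
  "wf_term S (Var x) \<longleftrightarrow> True"
| "wf_term S (Fun f ts) \<longleftrightarrow> (f, length ts) \<in> set S \<and> (\<forall>t\<in>set ts. wf_term S t)"

text \<open>Distinctness of the symbol names says that the arities are fixed and that constructors
  and defined symbols are disjoint.\<close>

definition constructor_trs :: "trs \<Rightarrow> bool" where
  "constructor_trs R \<longleftrightarrow>
     distinct (map fst (symbols R)) \<and>
     (\<forall>(l, r)\<in>set (rules R).
        (\<exists>f ts. l = Fun f ts \<and> (f, length ts) \<in> set (defined_syms R) \<and>
                (\<forall>t\<in>set ts. wf_term (constructors R) t)) \<and>
        wf_term (symbols R) r \<and> vars r \<subseteq> vars l)"

definition left_linear :: "trs \<Rightarrow> bool" where
  "left_linear R \<longleftrightarrow> (\<forall>(l, r)\<in>set (rules R). distinct (var_occs l))"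

text \<open>The two substitutions are independent, so the rules need not be renamed apart.  Only the
  overlap of a rule with itself at the root is exempted.\<close>

definition non_overlapping :: "trs \<Rightarrow> bool" where
  "non_overlapping R \<longleftrightarrow>
     (\<forall>(l1, r1)\<in>set (rules R). \<forall>(l2, r2)\<in>set (rules R). \<forall>u\<in>subterms l2.
        (\<forall>x. u \<noteq> Var x) \<longrightarrow> \<not> ((l1, r1) = (l2, r2) \<and> u = l2) \<longrightarrow>
        \<not> (\<exists>\<sigma> \<tau>. subst \<sigma> l1 = subst \<tau> u))"

definition orthogonal_trs :: "trs \<Rightarrow> bool" where
  "orthogonal_trs R \<longleftrightarrow> left_linear R \<and> non_overlapping R"


section \<open>Max-plus functions over the nonnegative reals\<close>

text \<open>A normal form is the list of its rows \<open>[\<alpha>\<^sub>i\<^sub>,\<^sub>0, \<alpha>\<^sub>i\<^sub>,\<^sub>1, \<dots>, \<alpha>\<^sub>i\<^sub>,\<^sub>n]\<close>, with the constant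
  coefficient first.\<close>

type_synonym maxplus = "real list list"

definition normal_form :: "nat \<Rightarrow> maxplus \<Rightarrow> bool" where
  "normal_form n Q \<longleftrightarrow>
     Q \<noteq> [] \<and> (\<forall>row\<in>set Q. length row = Suc n \<and> (\<forall>\<alpha>\<in>set row. 0 \<le> \<alpha>))"

definition row_eval :: "real list \<Rightarrow> real list \<Rightarrow> real" where
  "row_eval row xs = (\<Sum>j<length xs. row ! Suc j * xs ! j) + row ! 0"

definition mp_eval :: "maxplus \<Rightarrow> real list \<Rightarrow> real" where
  "mp_eval Q xs = Max ((\<lambda>row. row_eval row xs) ` set Q)"

definition plus_degree :: "maxplus \<Rightarrow> real" where
  "plus_degree Q = Max (\<Union>row\<in>set Q. set row)"

definition max_degree :: "maxplus \<Rightarrow> nat" where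
  "max_degree Q = length Q"

definition nonneg_vecs :: "nat \<Rightarrow> real list set" where
  "nonneg_vecs n = {xs. length xs = n \<and> (\<forall>x\<in>set xs. 0 \<le> x)}"

definition represents :: "nat \<Rightarrow> maxplus \<Rightarrow> (real list \<Rightarrow> real) \<Rightarrow> bool" where
  "represents n Q F \<longleftrightarrow> normal_form n Q \<and> (\<forall>xs\<in>nonneg_vecs n. F xs = mp_eval Q xs)"

definition MaxPlus :: "nat \<Rightarrow> (real list \<Rightarrow> real) set" where
  "MaxPlus n = {F. \<exists>Q. represents n Q F}"

definition MaxPlus_deg :: "nat \<Rightarrow> real \<Rightarrow> nat \<Rightarrow> (real list \<Rightarrow> real) set" where
  "MaxPlus_deg k d n =
     {F. \<exists>Q. represents n Q F \<and> plus_degree Q \<le> d \<and> max_degree Q \<le> k}"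


section \<open>Assignments and quasi-interpretations\<close>

type_synonym assignment = "nat \<Rightarrow> real list \<Rightarrow> real"

fun interp :: "assignment \<Rightarrow> (nat \<Rightarrow> real) \<Rightarrow> trm \<Rightarrow> real" where
  "interp I v (Var x) = v x"
| "interp I v (Fun f ts) = I f (map (interp I v) ts)"

text \<open>The interpretation of \<open>t\<close> as a function of the variables listed in \<open>xs\<close>.\<close>

definition term_fun :: "assignment \<Rightarrow> nat list \<Rightarrow> trm \<Rightarrow> real list \<Rightarrow> real" where
  "term_fun I xs t = (\<lambda>ys. interp I (\<lambda>x. the (map_of (zip xs ys) x)) t)"

definition is_assignment :: "trs \<Rightarrow> assignment \<Rightarrow> bool" where
  "is_assignment R I \<longleftrightarrow> (\<forall>(f, n)\<in>set (symbols R). I f \<in> MaxPlus n)"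

definition assignment_in_deg :: "trs \<Rightarrow> nat \<Rightarrow> real \<Rightarrow> assignment \<Rightarrow> bool" where
  "assignment_in_deg R k d I \<longleftrightarrow>
     is_assignment R I \<and>
     (\<forall>(l, r)\<in>set (rules R).
        let xs = sorted_list_of_set (vars l) in
          term_fun I xs l \<in> MaxPlus_deg k d (length xs) \<and>
          term_fun I xs r \<in> MaxPlus_deg k d (length xs))"

definition quasi_interpretation :: "trs \<Rightarrow> assignment \<Rightarrow> bool" where
  "quasi_interpretation R I \<longleftrightarrow>
     is_assignment R I \<and>
     (\<forall>(f, n)\<in>set (symbols R).
        (\<forall>xs\<in>nonneg_vecs n. \<forall>ys\<in>nonneg_vecs n. list_all2 (\<le>) xs ys \<longrightarrow> I f xs \<le> I f ys) \<and>
        (\<forall>xs\<in>nonneg_vecs n. \<forall>i<n. xs ! i \<le> I f xs)) \<and>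
     (\<forall>(l, r)\<in>set (rules R). \<forall>v. (\<forall>x. 0 \<le> v x) \<longrightarrow> interp I v r \<le> interp I v l)"


section \<open>A real-number machine with unit cost\<close>

text \<open>Programs are lists of first-order, possibly mutually recursive function bodies, working on
  binary trees whose leaves are either empty or hold one real number.  Constructing and taking
  apart a pair, testing for a pair, ring operations, order tests, access to an argument and
  function calls each cost one step.  The only machine constants are integers, so a program
  carries no non-computable information.\<close>

datatype data = DNil | DNum real | DPair data data

datatype expr =
    Arg nat
  | NilE
  | IntE int
  | PairE expr expr
  | FstE expr
  | SndE expr
  | AddE expr expr
  | SubE expr expr
  | MulE expr expr
  | IfPair expr expr expr
  | IfLess expr expr expr expr
  | Call nat "expr list"

type_synonym program = "expr list"

text \<open>\<open>eval P env e v t\<close>: in the argument environment \<open>env\<close>, \<open>e\<close> evaluates to \<open>v\<close> in exactly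
  \<open>t\<close> steps.  There is no derivation for a diverging or ill-typed computation.\<close>

inductive eval :: "program \<Rightarrow> data list \<Rightarrow> expr \<Rightarrow> data \<Rightarrow> nat \<Rightarrow> bool"
  and evals :: "program \<Rightarrow> data list \<Rightarrow> expr list \<Rightarrow> data list \<Rightarrow> nat \<Rightarrow> bool"
  for P :: program where
  eval_Arg: "i < length env \<Longrightarrow> eval P env (Arg i) (env ! i) 1"
| eval_Nil: "eval P env NilE DNil 1"
| eval_Int: "eval P env (IntE c) (DNum (of_int c)) 1"
| eval_Pair: "eval P env a u s \<Longrightarrow> eval P env b v t \<Longrightarrow>
    eval P env (PairE a b) (DPair u v) (s + t + 1)"
| eval_Fst: "eval P env a (DPair u v) t \<Longrightarrow> eval P env (FstE a) u (t + 1)"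
| eval_Snd: "eval P env a (DPair u v) t \<Longrightarrow> eval P env (SndE a) v (t + 1)"
| eval_Add: "eval P env a (DNum x) s \<Longrightarrow> eval P env b (DNum y) t \<Longrightarrow>
    eval P env (AddE a b) (DNum (x + y)) (s + t + 1)"
| eval_Sub: "eval P env a (DNum x) s \<Longrightarrow> eval P env b (DNum y) t \<Longrightarrow>
    eval P env (SubE a b) (DNum (x - y)) (s + t + 1)"
| eval_Mul: "eval P env a (DNum x) s \<Longrightarrow> eval P env b (DNum y) t \<Longrightarrow>
    eval P env (MulE a b) (DNum (x * y)) (s + t + 1)"
| eval_IfPair_True: "eval P env a (DPair u w) s \<Longrightarrow> eval P env b v t \<Longrightarrow>
    eval P env (IfPair a b c) v (s + t + 1)"
| eval_IfPair_False: "eval P env a u s \<Longrightarrow> (\<And>u1 u2. u \<noteq> DPair u1 u2) \<Longrightarrow> eval P env c v t \<Longrightarrow>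
    eval P env (IfPair a b c) v (s + t + 1)"
| eval_IfLess_True: "eval P env a (DNum x) s \<Longrightarrow> eval P env b (DNum y) s' \<Longrightarrow> x < y \<Longrightarrow>
    eval P env c v t \<Longrightarrow> eval P env (IfLess a b c e) v (s + s' + t + 1)"
| eval_IfLess_False: "eval P env a (DNum x) s \<Longrightarrow> eval P env b (DNum y) s' \<Longrightarrow> \<not> x < y \<Longrightarrow>
    eval P env e v t \<Longrightarrow> eval P env (IfLess a b c e) v (s + s' + t + 1)"
| eval_Call: "evals P env es vs s \<Longrightarrow> f < length P \<Longrightarrow> eval P vs (P ! f) v t \<Longrightarrow>
    eval P env (Call f es) v (s + t + 1)"
| evals_Nil: "evals P env [] [] 0"
| evals_Cons: "eval P env e v s \<Longrightarrow> evals P env es vs t \<Longrightarrow>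
    evals P env (e # es) (v # vs) (s + t)"

inductive_cases eval_elims:
  "eval P env (Arg i) v t"
  "eval P env NilE v t"
  "eval P env (IntE c) v t"
  "eval P env (PairE a b) v t"
  "eval P env (FstE a) v t"
  "eval P env (SndE a) v t"
  "eval P env (AddE a b) v t"
  "eval P env (SubE a b) v t"
  "eval P env (MulE a b) v t"
  "eval P env (IfPair a b c) v t"
  "eval P env (IfLess a b c e) v t"
  "eval P env (Call f es) v t"
  "evals P env [] vs t"
  "evals P env (e # es) vs t"

text \<open>The machine is deterministic, so result and running time are well defined.\<close>

lemma eval_evals_deterministic:
  "eval P env e v t \<Longrightarrow> eval P env e v' t' \<Longrightarrow> v' = v \<and> t' = t"
  "evals P env es vs t \<Longrightarrow> evals P env es vs' t' \<Longrightarrow> vs' = vs \<and> t' = t"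
proof (induction arbitrary: v' t' and vs' t' rule: eval_evals.inducts)
  case eval_Arg
  from eval_Arg.prems show ?case
    by (auto elim!: eval_elims(1))
next
  case eval_Nil
  from eval_Nil.prems show ?case
    by (auto elim!: eval_elims(2))
next
  case eval_Int
  from eval_Int.prems show ?case
    by (auto elim!: eval_elims(3))
next
  case eval_Pair
  from eval_Pair.prems show ?case
    by (auto elim!: eval_elims(4) dest!: eval_Pair.IH(2,4))
next
  case eval_Fst
  from eval_Fst.prems show ?case
    by (auto elim!: eval_elims(5) dest!: eval_Fst.IH(2))
next
  case eval_Snd
  from eval_Snd.prems show ?case
    by (auto elim!: eval_elims(6) dest!: eval_Snd.IH(2))
next
  case eval_Add
  from eval_Add.prems show ?case
    by (auto elim!: eval_elims(7) dest!: eval_Add.IH(2,4))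
next
  case eval_Sub
  from eval_Sub.prems show ?case
    by (auto elim!: eval_elims(8) dest!: eval_Sub.IH(2,4))
next
  case eval_Mul
  from eval_Mul.prems show ?case
    by (auto elim!: eval_elims(9) dest!: eval_Mul.IH(2,4))
next
  case eval_IfPair_True
  from eval_IfPair_True.prems show ?case
    by (auto elim!: eval_elims(10) dest!: eval_IfPair_True.IH(2,4))
next
  case eval_IfPair_False
  from eval_IfPair_False.prems eval_IfPair_False.hyps show ?case
    by (auto elim!: eval_elims(10) dest!: eval_IfPair_False.IH(2,4))
next
  case eval_IfLess_True
  from eval_IfLess_True.prems eval_IfLess_True.hyps show ?case
    by (auto elim!: eval_elims(11) dest!: eval_IfLess_True.IH(2,4,6))
next
  case eval_IfLess_False
  from eval_IfLess_False.prems eval_IfLess_False.hyps show ?case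
    by (auto elim!: eval_elims(11) dest!: eval_IfLess_False.IH(2,4,6))
next
  case eval_Call
  from eval_Call.prems show ?case
    by (auto elim!: eval_elims(12) dest!: eval_Call.IH(2,5))
next
  case evals_Nil
  from evals_Nil.prems show ?case
    by (auto elim!: eval_elims(13))
next
  case evals_Cons
  from evals_Cons.prems show ?case
    by (auto elim!: eval_elims(14) dest!: evals_Cons.IH(2,4))
qed

text \<open>The main function is the first one.\<close>

definition runs :: "program \<Rightarrow> data \<Rightarrow> data \<Rightarrow> nat \<Rightarrow> bool" where
  "runs P x v t \<longleftrightarrow> P \<noteq> [] \<and> eval P [x] (P ! 0) v t"


section \<open>Encoding of the input\<close>

fun enc_list :: "data list \<Rightarrow> data" where
  "enc_list [] = DNil"
| "enc_list (x # xs) = DPair x (enc_list xs)"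

definition enc_nat :: "nat \<Rightarrow> data" where
  "enc_nat n = DNum (of_nat n)"

fun enc_trm :: "trm \<Rightarrow> data" where
  "enc_trm (Var x) = DPair (DNum 0) (enc_nat x)"
| "enc_trm (Fun f ts) = DPair (DNum 1) (DPair (enc_nat f) (enc_list (map enc_trm ts)))"

definition enc_signature :: "signature \<Rightarrow> data" where
  "enc_signature S = enc_list (map (\<lambda>(f, n). DPair (enc_nat f) (enc_nat n)) S)"

definition enc_trs :: "trs \<Rightarrow> data" where
  "enc_trs R =
     DPair (enc_signature (constructors R))
       (DPair (enc_signature (defined_syms R))
         (enc_list (map (\<lambda>(l, r). DPair (enc_trm l) (enc_trm r)) (rules R))))"

definition enc_maxplus :: "maxplus \<Rightarrow> data" where
  "enc_maxplus Q = enc_list (map (\<lambda>row. enc_list (map DNum row)) Q)"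

text \<open>The assignment is passed as a table that gives a normal form \<open>A f\<close> for every symbol \<open>f\<close>.\<close>

definition enc_table :: "trs \<Rightarrow> (nat \<Rightarrow> maxplus) \<Rightarrow> data" where
  "enc_table R A =
     enc_list (map (\<lambda>(f, n). DPair (enc_nat f) (enc_maxplus (A f))) (symbols R))"

definition enc_input :: "trs \<Rightarrow> (nat \<Rightarrow> maxplus) \<Rightarrow> data" where
  "enc_input R A = DPair (enc_trs R) (enc_table R A)"

text \<open>The bound on the number of rows keeps the input itself polynomial in \<open>k\<close>.  It does not
  follow from \<open>assignment_in_deg\<close>: with \<open>f(c) \<rightarrow> c\<close> as only rule, the normal form of the
  symbol \<open>f\<close> may have arbitrarily many irredundant rows although both sides are constants.\<close>

definition given_by_table :: "trs \<Rightarrow> nat \<Rightarrow> assignment \<Rightarrow> (nat \<Rightarrow> maxplus) \<Rightarrow> bool" where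
  "given_by_table R k I A \<longleftrightarrow>
     (\<forall>(f, n)\<in>set (symbols R). represents n (A f) (I f) \<and> max_degree (A f) \<le> k)"

text \<open>Polynomials in two variables are polynomials in the second variable whose coefficients are
  polynomials in the first.\<close>

definition poly2 :: "real poly poly \<Rightarrow> real \<Rightarrow> real \<Rightarrow> real" where
  "poly2 p x y = poly (poly p [:y:]) x"

end

theory Submission
  imports Defs
begin

text \<open>The interpretation of a term is expanded into rows over the variables of the left-hand side;
  a fixed term yields polynomially many rows in \<open>k\<close>.  A row \<open>r\<close> lies below the maximum of the rows
  \<open>q\<^sub>1, \<dots>, q\<^sub>m\<close> iff the strict system \<open>r - q\<^sub>i > 0\<close> has no nonnegative solution, which
  Fourier-Motzkin elimination decides.  Each elimination step squares the size of the system, but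
  the number of steps depends on the rule only, so the time is polynomial in \<open>k\<close>; it does not
  depend on \<open>d\<close>, arithmetic having unit cost.  The subterm property \<open>X\<^sub>i \<le> Q(X)\<close> is an inequality
  of the same kind, and monotonicity holds for every max-plus function.\<close>

section \<open>Rows\<close>

text \<open>A row may lie below a maximum without lying below any single row of it: X/2 + Y/2 <=
  max(X, Y). Comparing coefficients row by row is therefore too weak, and comparing two normal forms
  becomes a question of linear feasibility over the reals. The negated comparison is a conjunction
  of strict inequalities, so elimination meets only one kind of constraint; nonnegativity of the
  unknowns is built into the elimination step instead of being stored as further rows. One program
  serves all systems, while the polynomial may depend on the system: its degree grows with the
  nesting of the terms, the arities and the number of variables. Hence every time bound is a
  function of \<open>k\<close> that is fixed before \<open>k\<close> and the table are given. The
  functions on rows are defined with the same recursion as the program bodies, so that result and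
  running time of each body are proved together by one induction.\<close>

type_synonym row = "real list"

text \<open>One primitive for three purposes: the nonnegative sums of substitution, the differences
  of two rows, and the cancelling combinations of elimination.\<close>

definition comb :: "real \<Rightarrow> row \<Rightarrow> real \<Rightarrow> row \<Rightarrow> row" where
  "comb a p b q = map2 (\<lambda>x y. a * x + b * y) p q"

definition combs :: "real \<Rightarrow> row \<Rightarrow> real \<Rightarrow> row list \<Rightarrow> row list" where
  "combs a p b S = map (comb a p b) S"

text \<open>The Minkowski sum of \<open>Q\<close>, scaled by \<open>a\<close>, and
  \<open>S\<close>.\<close>

definition cross :: "real \<Rightarrow> row list \<Rightarrow> row list \<Rightarrow> row list" where
  "cross a Q S = concat (map (\<lambda>q. combs a q 1 S) Q)"

text \<open>The rows of the function a_1 max(E_1) + ... + a_n max(E_n) + b, obtained by choosing one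
  row from each \<open>E\<close> in every possible way.\<close>

fun lincomb :: "real list \<Rightarrow> row list list \<Rightarrow> row \<Rightarrow> row list" where
  "lincomb (a # as) (E # Es) b = cross a E (lincomb as Es b)"
| "lincomb _ _ b = [b]"

text \<open>With \<open>z\<close> the zero row, \<open>hd r # z\<close> is the constant part of
  \<open>r\<close>, read as a row over the new variables.\<close>

definition subst_rows :: "row list \<Rightarrow> row list list \<Rightarrow> row \<Rightarrow> row list" where
  "subst_rows Q Es z = concat (map (\<lambda>r. lincomb (tl r) Es (hd r # z)) Q)"

definition point :: "real list \<Rightarrow> real \<Rightarrow> row" where
  "point ys x = map (\<lambda>y. if y = x then 1 else 0) ys"

text \<open>Variables are natural numbers, so \<open>point (map real xs) (- 1)\<close> is the zero row.\<close>

fun expand :: "(nat \<Rightarrow> maxplus) \<Rightarrow> nat list \<Rightarrow> trm \<Rightarrow> row list" where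
  "expand A xs (Var x) = [0 # point (map real xs) (real x)]"
| "expand A xs (Fun f ts) =
     subst_rows (A f) (map (expand A xs) ts) (point (map real xs) (- 1))"

text \<open>Eliminates the nonnegative first unknown: a row whose head is at most 0 stays satisfied when the
  unknown is 0, and it is combined with every row of positive head.\<close>

definition elim_row :: "real \<Rightarrow> row \<Rightarrow> row list \<Rightarrow> row list" where
  "elim_row a p T = map (\<lambda>q. comb (hd q) p (- a) (tl q)) (filter (\<lambda>q. 0 < hd q) T)"

definition elim :: "row list \<Rightarrow> row list \<Rightarrow> row list" where
  "elim S T = concat (map (\<lambda>r. if 0 < hd r then [] else tl r # elim_row (hd r) (tl r) T) S)"

text \<open>Rows are homogeneous, so once no unknown is left every constraint reads 0 < 0: a single
  remaining row makes the system infeasible.\<close>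

fun infeasible :: "nat \<Rightarrow> row list \<Rightarrow> bool" where
  "infeasible 0 S \<longleftrightarrow> S \<noteq> []"
| "infeasible (Suc m) S \<longleftrightarrow> infeasible m (elim S S)"

definition dominated :: "nat \<Rightarrow> row list \<Rightarrow> row list \<Rightarrow> bool" where
  "dominated m P Q \<longleftrightarrow> (\<forall>r\<in>set P. infeasible m (combs 1 r (- 1) Q))"

text \<open>The coordinate projections. There are two lists because the recursion consumes
  \<open>ys\<close> while each row still ranges over all of \<open>xs\<close>.\<close>

definition unit_rows :: "real list \<Rightarrow> real list \<Rightarrow> row list" where
  "unit_rows ys xs = map (\<lambda>y. 0 # point xs y) ys"

definition rows :: "nat \<Rightarrow> row list \<Rightarrow> bool" where
  "rows m S \<longleftrightarrow> (\<forall>r\<in>set S. length r = m)"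

definition dot :: "row \<Rightarrow> real list \<Rightarrow> real" where
  "dot r v = sum_list (map2 (*) r v)"

text \<open>An attained upper bound instead of \<open>Max\<close>: nonemptiness is built in, and the
  property composes without finiteness side conditions.\<close>

definition is_max :: "row list \<Rightarrow> real list \<Rightarrow> real \<Rightarrow> bool" where
  "is_max E v m \<longleftrightarrow> (\<exists>r\<in>set E. dot r v = m) \<and> (\<forall>r\<in>set E. dot r v \<le> m)"

section \<open>Shapes and sizes of row lists\<close>

lemma rows_simps [simp]:
  "rows m []" "rows m (r # S) \<longleftrightarrow> length r = m \<and> rows m S"
  "rows m (S @ T) \<longleftrightarrow> rows m S \<and> rows m T"
  by (auto simp: rows_def)

lemma dot_simps [simp]:
  "dot [] v = 0" "dot r [] = 0" "dot (a # r) (x # v) = a * x + dot r v"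
  by (simp_all add: dot_def)

lemma length_comb [simp]: "length (comb a p b q) = min (length p) (length q)"
  by (simp add: comb_def)

lemma comb_simps [simp]:
  "comb a [] b q = []" "comb a (x # p) b (y # q) = (a * x + b * y) # comb a p b q"
  by (simp_all add: comb_def)

lemma combs_simps [simp]:
  "combs a p b [] = []" "combs a p b (q # S) = comb a p b q # combs a p b S"
  by (simp_all add: combs_def)

lemma length_combs [simp]: "length (combs a p b S) = length S"
  by (simp add: combs_def)

lemma rows_combs: "length p = m \<Longrightarrow> rows m S \<Longrightarrow> rows m (combs a p b S)"
  by (auto simp: combs_def rows_def)

lemma cross_simps [simp]:
  "cross a [] S = []" "cross a (q # Q) S = combs a q 1 S @ cross a Q S"
  by (simp_all add: cross_def)

lemma length_cross [simp]: "length (cross a Q S) = length Q * length S"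
  by (induction Q) simp_all

lemma rows_cross: "rows m Q \<Longrightarrow> rows m S \<Longrightarrow> rows m (cross a Q S)"
  by (induction Q) (auto simp: rows_combs)

lemma rows_lincomb:
  "(\<And>E. E \<in> set Es \<Longrightarrow> rows m E) \<Longrightarrow> length b = m \<Longrightarrow> rows m (lincomb as Es b)"
  by (induction as Es b rule: lincomb.induct) (auto intro!: rows_cross)

lemma subst_rows_simps [simp]:
  "subst_rows [] Es z = []"
  "subst_rows (r # Q) Es z = lincomb (tl r) Es (hd r # z) @ subst_rows Q Es z"
  by (simp_all add: subst_rows_def)

lemma rows_subst_rows:
  "(\<And>E. E \<in> set Es \<Longrightarrow> rows (Suc m) E) \<Longrightarrow> length z = m \<Longrightarrow> rows (Suc m) (subst_rows Q Es z)"
  by (induction Q) (auto intro!: rows_lincomb)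

lemma point_simps [simp]:
  "point [] x = []" "point (y # ys) x = (if y = x then 1 else 0) # point ys x"
  by (simp_all add: point_def)

lemma length_point [simp]: "length (point ys x) = length ys"
  by (simp add: point_def)

lemma rows_expand: "rows (Suc (length xs)) (expand A xs t)"
  by (induction t) (auto intro!: rows_subst_rows)

lemma elim_row_simps [simp]:
  "elim_row a p [] = []"
  "elim_row a p (q # T) =
     (if 0 < hd q then comb (hd q) p (- a) (tl q) # elim_row a p T else elim_row a p T)"
  by (simp_all add: elim_row_def)

lemma length_elim_row: "length (elim_row a p T) \<le> length T"
  by (simp add: elim_row_def)

lemma rows_elim_row: "length p = m \<Longrightarrow> rows (Suc m) T \<Longrightarrow> rows m (elim_row a p T)"
  by (induction T) auto

lemma elim_simps [simp]:
  "elim [] T = []"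
  "elim (r # S) T = (if 0 < hd r then elim S T else tl r # elim_row (hd r) (tl r) T @ elim S T)"
  by (simp_all add: elim_def)

lemma length_elim: "length (elim S T) \<le> length S * (length T + 1)"
proof (induction S)
  case (Cons r S)
  then show ?case using length_elim_row[of "hd r" "tl r" T] by auto
qed simp

lemma rows_elim: "rows (Suc m) S \<Longrightarrow> rows (Suc m) T \<Longrightarrow> rows m (elim S T)"
  by (induction S) (auto simp: rows_elim_row)

lemma unit_rows_simps [simp]:
  "unit_rows [] xs = []" "unit_rows (y # ys) xs = (0 # point xs y) # unit_rows ys xs"
  by (simp_all add: unit_rows_def)

lemma length_unit_rows [simp]: "length (unit_rows ys xs) = length ys"
  by (simp add: unit_rows_def)

lemma rows_unit_rows: "rows (Suc (length xs)) (unit_rows ys xs)"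
  by (auto simp: unit_rows_def rows_def)

lemma dominated_simps [simp]:
  "dominated m [] Q"
  "dominated m (r # P) Q \<longleftrightarrow> infeasible m (combs 1 r (- 1) Q) \<and> dominated m P Q"
  by (simp_all add: dominated_def)

lemma infeasible_Nil [simp]: "\<not> infeasible m []"
  by (induction m) simp_all

section \<open>Semantics of rows\<close>

lemma dot_comb:
  "length p = length v \<Longrightarrow> length q = length v \<Longrightarrow>
   dot (comb a p b q) v = a * dot p v + b * dot q v"
proof (induction v arbitrary: p q)
  case (Cons x v)
  then obtain c p' d q' where "p = c # p'" "q = d # q'" by (metis length_Suc_conv)
  with Cons show ?case by (simp add: algebra_simps)
qed simp

text \<open>Scaling by a nonnegative number preserves the order of the values, and a sum of two
  maxima is attained by the pair of maximal rows.\<close>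

lemma is_max_cross:
  assumes "is_max Q v m" "is_max S v n" "0 \<le> a" "rows (length v) Q" "rows (length v) S"
  shows "is_max (cross a Q S) v (a * m + n)"
proof -
  have dot: "dot (comb a q 1 s) v = a * dot q v + dot s v" if "q \<in> set Q" "s \<in> set S" for q s
    using that assms dot_comb[of q v s a 1] by (auto simp: rows_def)
  show ?thesis
    using assms(1-3) dot unfolding is_max_def cross_def combs_def
    by (auto intro!: add_mono mult_left_mono)
qed

lemma is_max_lincomb:
  assumes "list_all2 (\<lambda>E m. is_max E v m \<and> rows (length v) E) Es ms" "length as = length Es"
    "\<forall>a\<in>set as. 0 \<le> a" "length b = length v"
  shows "is_max (lincomb as Es b) v (dot as ms + dot b v)"
  using assms
proof (induction as Es b arbitrary: ms rule: lincomb.induct)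
  case (1 a as E Es b)
  then obtain m ms' where ms: "ms = m # ms'" "is_max E v m" "rows (length v) E"
    "list_all2 (\<lambda>E m. is_max E v m \<and> rows (length v) E) Es ms'"
    by (auto simp: list_all2_Cons1)
  have "rows (length v) (lincomb as Es b)"
    using ms(4) 1(5) by (intro rows_lincomb) (auto simp: list_all2_conv_all_nth in_set_conv_nth)
  then have "is_max (cross a E (lincomb as Es b)) v (a * m + (dot as ms' + dot b v))"
    using 1 ms by (intro is_max_cross) auto
  then show ?case by (simp add: ms algebra_simps)
qed (auto simp: is_max_def)

lemma is_max_concat:
  assumes "xs \<noteq> []" "\<And>x. x \<in> set xs \<Longrightarrow> is_max (f x) v (g x)"
  shows "is_max (concat (map f xs)) v (Max (g ` set xs))"
proof -
  have "Max (g ` set xs) \<in> g ` set xs" using assms(1) by (intro Max_in) auto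
  then obtain x where "x \<in> set xs" "g x = Max (g ` set xs)" by auto
  moreover from this obtain r where "r \<in> set (f x)" "dot r v = Max (g ` set xs)"
    using assms(2) unfolding is_max_def by metis
  moreover have "dot r v \<le> Max (g ` set xs)" if "r \<in> set (f x)" "x \<in> set xs" for r x
  proof -
    have "dot r v \<le> g x" using assms(2) that unfolding is_max_def by blast
    also have "\<dots> \<le> Max (g ` set xs)" using that by (intro Max_ge) auto
    finally show ?thesis .
  qed
  ultimately show ?thesis unfolding is_max_def by auto
qed

lemma dot_eq_sum:
  "length r = length v \<Longrightarrow> dot r v = (\<Sum>j<length v. r ! j * v ! j)"
  by (auto simp: dot_def sum_list_sum_nth atLeast0LessThan intro!: sum.cong)

text \<open>Prefixing the point by 1 turns the affine form of a row into a linear one.\<close>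

lemma row_eval_eq_dot: "length r = Suc (length xs) \<Longrightarrow> row_eval r xs = dot r (1 # xs)"
  by (cases r) (simp_all add: row_eval_def dot_eq_sum)

lemma is_max_subst_rows:
  assumes "normal_form (length Es) Q" "length z = length v - 1" "v = 1 # w" "dot z w = 0"
    "list_all2 (\<lambda>E m. is_max E v m \<and> rows (length v) E) Es ms"
  shows "is_max (subst_rows Q Es z) v (mp_eval Q ms)"
  unfolding subst_rows_def mp_eval_def
proof (rule is_max_concat)
  fix r assume "r \<in> set Q"
  then have r: "length r = Suc (length Es)" "\<forall>a\<in>set r. 0 \<le> a"
    using assms(1) by (auto simp: normal_form_def)
  then obtain a as where [simp]: "r = a # as" by (cases r) auto
  have "length ms = length Es" using assms(5) by (simp add: list_all2_lengthD)
  then have "row_eval r ms = dot as ms + dot (a # z) v"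
    using r assms by (simp add: row_eval_eq_dot)
  then show "is_max (lincomb (tl r) Es (hd r # z)) v (row_eval r ms)"
    using is_max_lincomb[OF assms(5), of as "a # z"] r assms by auto
qed (use assms in \<open>simp add: normal_form_def\<close>)

lemma dot_point:
  "distinct xs \<Longrightarrow> dot (point (map real xs) (real x)) (map v xs) = (if x \<in> set xs then v x else 0)"
  by (induction xs) auto

lemma dot_point_out: "dot (point (map real xs) (- 1)) (map v xs) = 0"
proof (induction xs)
  case (Cons x xs)
  have "real x \<noteq> - 1" by (metis of_nat_0_le_iff neg_0_le_iff_le not_one_le_zero)
  with Cons show ?case by simp
qed simp

lemma mp_eval_nonneg:
  assumes "normal_form n Q" "xs \<in> nonneg_vecs n"
  shows "0 \<le> mp_eval Q xs"
proof -
  obtain r Q' where Q: "Q = r # Q'" using assms by (cases Q) (auto simp: normal_form_def)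
  have "0 \<le> row_eval r xs" using assms Q
    by (auto simp: row_eval_def normal_form_def nonneg_vecs_def
        intro!: sum_nonneg add_nonneg_nonneg mult_nonneg_nonneg)
  also have "\<dots> \<le> mp_eval Q xs" unfolding mp_eval_def Q by (intro Max_ge) auto
  finally show ?thesis .
qed

text \<open>\<open>represents\<close> speaks about nonnegative arguments only, so it applies to a
  compound term once its arguments are known to have nonnegative values.\<close>

lemma interp_nonneg:
  assumes "\<And>f n. (f, n) \<in> set S \<Longrightarrow> represents n (A f) (I f)" "\<And>x. 0 \<le> v x"
  shows "wf_term S t \<Longrightarrow> 0 \<le> interp I v t"
proof (induction t)
  case (Fun f ts)
  then have "map (interp I v) ts \<in> nonneg_vecs (length ts)" by (auto simp: nonneg_vecs_def)
  with assms(1)[of f "length ts"] Fun.prems show ?case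
    by (auto simp: represents_def dest!: mp_eval_nonneg[of "length ts" "A f"])
qed (use assms in simp)

text \<open>Distinctness of \<open>xs\<close> matters: \<open>point\<close> writes a 1 at every
  occurrence of the variable, so a repeated entry would count its value repeatedly.\<close>

lemma is_max_expand:
  assumes rep: "\<And>f n. (f, n) \<in> set S \<Longrightarrow> represents n (A f) (I f)" and v: "\<And>x. 0 \<le> v x"
    and xs: "distinct xs"
  shows "wf_term S t \<Longrightarrow> vars t \<subseteq> set xs \<Longrightarrow>
    is_max (expand A xs t) (1 # map v xs) (interp I v t)"
proof (induction t)
  case (Var x)
  then show ?case using xs by (simp add: is_max_def dot_point vars_def)
next
  case (Fun f ts)
  let ?ms = "map (interp I v) ts"
  have IH: "is_max (expand A xs t) (1 # map v xs) (interp I v t)" if "t \<in> set ts" for t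
    using Fun that by (auto simp: vars_def)
  have "list_all2 (\<lambda>E m. is_max E (1 # map v xs) m \<and> rows (length (1 # map v xs)) E)
      (map (expand A xs) ts) ?ms"
    using IH rows_expand[of xs A] by (auto simp: list_all2_conv_all_nth)
  moreover have nf: "represents (length ts) (A f) (I f)" using Fun.prems rep by auto
  moreover have "?ms \<in> nonneg_vecs (length ts)"
    using Fun.prems interp_nonneg[OF rep v] by (auto simp: nonneg_vecs_def)
  ultimately show ?case
    using is_max_subst_rows[of "map (expand A xs) ts" "A f" "point (map real xs) (- 1)"
        "1 # map v xs" "map v xs" ?ms]
    by (auto simp: represents_def dot_point_out)
qed

subsection \<open>Fourier-Motzkin elimination\<close>

text \<open>The lower bounds of an eliminated unknown always include 0, whereas upper bounds may be
  absent; this accounts for the asymmetric treatment of \<open>L\<close> and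
  \<open>U\<close>.\<close>

lemma ex_between_finite:
  fixes L U :: "real set"
  assumes "finite L" "finite U" "\<And>l u. l \<in> L \<Longrightarrow> u \<in> U \<Longrightarrow> l < u" "L \<noteq> {}"
  shows "\<exists>a. (\<forall>l\<in>L. l < a) \<and> (\<forall>u\<in>U. a < u)"
proof (cases "U = {}")
  case True
  have "l < Max L + 1" if "l \<in> L" for l using Max_ge[OF assms(1) that] by simp
  with True show ?thesis by auto
next
  case False
  with assms have "Max L < Min U" by simp
  then obtain a where "Max L < a" "a < Min U" using dense by blast
  then show ?thesis using assms False by auto
qed

text \<open>A row bounds the unknown \<open>a\<close> from below if its head is positive and from
  above if its head is negative. A suitable \<open>a\<close> exists iff every lower bound is smaller
  than every upper bound; comparison with the lower bound 0 yields positivity of the tail.\<close>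

lemma elim_correct:
  "(\<exists>a\<ge>0. \<forall>r\<in>set S. 0 < hd r * a + dot (tl r) y) \<longleftrightarrow>
   (\<forall>r\<in>set S. hd r \<le> 0 \<longrightarrow> 0 < dot (tl r) y \<and>
      (\<forall>q\<in>set S. 0 < hd q \<longrightarrow> 0 < hd q * dot (tl r) y + (- hd r) * dot (tl q) y))"
  (is "?L \<longleftrightarrow> ?R")
proof
  assume ?L
  then obtain a where a: "a \<ge> 0" "\<And>r. r \<in> set S \<Longrightarrow> 0 < hd r * a + dot (tl r) y" by blast
  show ?R
  proof (intro ballI impI conjI)
    fix r assume r: "r \<in> set S" "hd r \<le> 0"
    have "hd r * a \<le> 0" using r a(1) by (simp add: mult_nonpos_nonneg)
    then show "0 < dot (tl r) y" using a(2)[OF r(1)] by linarith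
    fix q assume q: "q \<in> set S" "0 < hd q"
    \<comment> \<open>The weights \<open>hd q\<close> and \<open>- hd r\<close> cancel the unknown.
      The second may be 0, so strictness has to come from the first.\<close>
    have "0 < hd q * (hd r * a + dot (tl r) y)" using q a(2)[OF r(1)] by simp
    moreover have "0 \<le> (- hd r) * (hd q * a + dot (tl q) y)"
      using r a(2)[OF q(1)] by (intro mult_nonneg_nonneg) auto
    ultimately show "0 < hd q * dot (tl r) y + (- hd r) * dot (tl q) y"
      by (simp add: algebra_simps)
  qed
next
  assume R: ?R
  \<comment> \<open>The constraint that the unknown is nonnegative enters as the lower bound
    0.\<close>
  define L where "L = insert 0 ((\<lambda>q. - dot (tl q) y / hd q) ` {q \<in> set S. 0 < hd q})"
  define U where "U = (\<lambda>r. dot (tl r) y / - hd r) ` {r \<in> set S. hd r < 0}"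
  have "\<exists>a. (\<forall>l\<in>L. l < a) \<and> (\<forall>u\<in>U. a < u)"
  proof (rule ex_between_finite)
    fix l u assume "l \<in> L" "u \<in> U"
    then obtain r where r: "r \<in> set S" "hd r < 0" "u = dot (tl r) y / - hd r"
      by (auto simp: U_def)
    show "l < u"
    proof (cases "l = 0")
      case True
      have "0 < dot (tl r) y" using R r by force
      then have "0 < u" unfolding r(3) using r(2) by (intro divide_pos_pos) auto
      with True show ?thesis by simp
    next
      case False
      then obtain q where q: "q \<in> set S" "0 < hd q" "l = - dot (tl q) y / hd q"
        using \<open>l \<in> L\<close> by (auto simp: L_def)
      have *: "0 < hd q * dot (tl r) y + (- hd r) * dot (tl q) y" using R r q by force
      have "- dot (tl q) y * - hd r < dot (tl r) y * hd q" using * by (simp add: algebra_simps)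
      then have "- dot (tl q) y / hd q < dot (tl r) y / - hd r"
        using r(2) q(2) by (subst pos_divide_less_eq, simp, subst times_divide_eq_left,
            subst pos_less_divide_eq) simp_all
      then show ?thesis unfolding r(3) q(3) .
    qed
  qed (auto simp: L_def U_def)
  then obtain a where a: "\<And>l. l \<in> L \<Longrightarrow> l < a" "\<And>u. u \<in> U \<Longrightarrow> a < u" by blast
  have "0 < hd r * a + dot (tl r) y" if r: "r \<in> set S" for r
  proof -
    consider "hd r = 0" | "hd r < 0" | "hd r > 0" by linarith
    then show ?thesis
    proof cases
      case 1
      then show ?thesis using R r by auto
    next
      case 2
      then have "a < dot (tl r) y / - hd r" using a(2) r by (auto simp: U_def)
      then show ?thesis using 2 by (simp add: field_simps)
    next
      case 3
      then have "- dot (tl r) y / hd r < a" using a(1) r by (auto simp: L_def)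
      then show ?thesis using 3 by (simp add: field_simps)
    qed
  qed
  moreover have "0 < a" using a(1) by (simp add: L_def)
  ultimately show ?L by (intro exI[of _ a]) auto
qed

lemma elim_positive:
  assumes "rows (Suc (length y)) S"
  shows "(\<forall>r\<in>set (elim S S). 0 < dot r y) \<longleftrightarrow> (\<exists>a\<ge>0. \<forall>r\<in>set S. 0 < dot r (a # y))"
proof -
  have len: "length (tl r) = length y \<and> dot r (a # y) = hd r * a + dot (tl r) y"
    if "r \<in> set S" for r a
  proof -
    have "length r = Suc (length y)" using that assms by (simp add: rows_def)
    then show ?thesis by (cases r) simp_all
  qed
  have comb: "dot (comb (hd q) (tl r) (- hd r) (tl q)) y =
      hd q * dot (tl r) y + (- hd r) * dot (tl q) y" if "r \<in> set S" "q \<in> set S" for r q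
    using len[OF that(1)] len[OF that(2)] by (intro dot_comb) blast+
  have "(\<forall>r\<in>set (elim S S). 0 < dot r y) \<longleftrightarrow>
      (\<forall>r\<in>set S. hd r \<le> 0 \<longrightarrow> 0 < dot (tl r) y \<and>
        (\<forall>q\<in>set S. 0 < hd q \<longrightarrow> 0 < dot (comb (hd q) (tl r) (- hd r) (tl q)) y))"
    by (auto simp: elim_def elim_row_def not_less)
  also have "\<dots> \<longleftrightarrow> (\<forall>r\<in>set S. hd r \<le> 0 \<longrightarrow> 0 < dot (tl r) y \<and>
      (\<forall>q\<in>set S. 0 < hd q \<longrightarrow> 0 < hd q * dot (tl r) y + (- hd r) * dot (tl q) y))"
    by (intro ball_cong imp_cong conj_cong refl) (simp_all only: comb)
  also have "\<dots> \<longleftrightarrow> (\<exists>a\<ge>0. \<forall>r\<in>set S. 0 < dot r (a # y))"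
    unfolding elim_correct[symmetric] using len by (metis (no_types, lifting))
  finally show ?thesis .
qed

lemma infeasible_iff:
  "rows m S \<Longrightarrow> infeasible m S \<longleftrightarrow> \<not> (\<exists>y\<in>nonneg_vecs m. \<forall>r\<in>set S. 0 < dot r y)"
proof (induction m arbitrary: S)
  case 0
  then show ?case by (cases S) (auto simp: nonneg_vecs_def)
next
  case (Suc m)
  have "infeasible (Suc m) S \<longleftrightarrow> \<not> (\<exists>y\<in>nonneg_vecs m. \<forall>r\<in>set (elim S S). 0 < dot r y)"
    using Suc by (simp add: rows_elim)
  also have "(\<exists>y\<in>nonneg_vecs m. \<forall>r\<in>set (elim S S). 0 < dot r y) \<longleftrightarrow>
      (\<exists>y\<in>nonneg_vecs m. \<exists>a\<ge>0. \<forall>r\<in>set S. 0 < dot r (a # y))"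
    using Suc.prems by (intro bex_cong refl elim_positive) (auto simp: nonneg_vecs_def)
  also have "\<dots> \<longleftrightarrow> (\<exists>y\<in>nonneg_vecs (Suc m). \<forall>r\<in>set S. 0 < dot r y)" (is "?L \<longleftrightarrow> ?R")
  proof
    assume ?L
    then obtain y a where "y \<in> nonneg_vecs m" "a \<ge> 0" "\<forall>r\<in>set S. 0 < dot r (a # y)" by blast
    then show ?R by (intro bexI[of _ "a # y"]) (auto simp: nonneg_vecs_def)
  next
    assume ?R
    then obtain y where "y \<in> nonneg_vecs (Suc m)" "\<forall>r\<in>set S. 0 < dot r y" by blast
    then show ?L by (cases y) (auto simp: nonneg_vecs_def)
  qed
  finally show ?case .
qed

text \<open>The constant coefficient is treated as one more unknown.  Strict inequalities survive a small
  increase of that unknown, which can therefore be made positive and then scaled to 1.\<close>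

lemma positive_homogenize:
  assumes "rows (Suc n) S" "x \<in> nonneg_vecs (Suc n)" "\<And>r. r \<in> set S \<Longrightarrow> 0 < dot r x"
  shows "\<exists>y\<in>nonneg_vecs n. \<forall>r\<in>set S. 0 < dot r (1 # y)"
proof -
  obtain a y where x: "x = a # y" "0 \<le> a" "y \<in> nonneg_vecs n"
    using assms(2) by (cases x) (auto simp: nonneg_vecs_def)
  have dot: "dot r (c # y) = hd r * c + dot (tl r) y" if "r \<in> set S" for r c
  proof -
    have "length r = Suc n" using that assms(1) by (simp add: rows_def)
    then show ?thesis by (cases r) simp_all
  qed
  have "eventually (\<lambda>c. \<forall>r\<in>set S. 0 < hd r * c + dot (tl r) y) (at_right a)"
  proof (intro eventually_ball_finite ballI)
    fix r assume r: "r \<in> set S"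
    have "((\<lambda>c. hd r * c + dot (tl r) y) \<longlongrightarrow> hd r * a + dot (tl r) y) (at_right a)"
      by (intro tendsto_intros)
    then show "eventually (\<lambda>c. 0 < hd r * c + dot (tl r) y) (at_right a)"
      using assms(3)[OF r] dot[OF r] x by (intro order_tendstoD) auto
  qed simp
  moreover have "eventually (\<lambda>c. c > a) (at_right a)" by (simp add: eventually_at_right_less)
  ultimately have "eventually (\<lambda>c. c > a \<and> (\<forall>r\<in>set S. 0 < hd r * c + dot (tl r) y)) (at_right a)"
    by (simp add: eventually_conj)
  then obtain c where c: "c > a" "\<And>r. r \<in> set S \<Longrightarrow> 0 < hd r * c + dot (tl r) y"
    using eventually_happens'[OF trivial_limit_at_right_real] by (metis (lifting))
  have scale: "dot r (map ((*) (1 / c)) y) = (1 / c) * dot r y" for r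
    by (induction r y rule: list_induct2') (simp_all add: algebra_simps)
  have "0 < dot r (1 # map ((*) (1 / c)) y)" if r: "r \<in> set S" for r
  proof -
    have "dot r (1 # map ((*) (1 / c)) y) = hd r + (1 / c) * dot (tl r) y"
      using dot[OF r, of 1] scale by (cases r) (auto simp: rows_def)
    also have "\<dots> = (hd r * c + dot (tl r) y) / c" using c x by (simp add: field_simps)
    also have "\<dots> > 0" using c x r by auto
    finally show ?thesis .
  qed
  moreover have "map ((*) (1 / c)) y \<in> nonneg_vecs n" using x c by (auto simp: nonneg_vecs_def)
  ultimately show ?thesis by blast
qed

text \<open>The row \<open>q\<close> may change with the point \<open>y\<close>, which makes this a
  comparison with the maximum of \<open>Q\<close> and not with one of its rows.\<close>

lemma dominated_iff:
  assumes "rows (Suc n) P" "rows (Suc n) Q"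
  shows "dominated (Suc n) P Q \<longleftrightarrow>
    (\<forall>y\<in>nonneg_vecs n. \<forall>r\<in>set P. \<exists>q\<in>set Q. dot r (1 # y) \<le> dot q (1 # y))"
proof -
  have "infeasible (Suc n) (combs 1 r (- 1) Q) \<longleftrightarrow>
      (\<forall>y\<in>nonneg_vecs n. \<exists>q\<in>set Q. dot r (1 # y) \<le> dot q (1 # y))" if r: "r \<in> set P" for r
  proof -
    have rws: "rows (Suc n) (combs 1 r (- 1) Q)"
      using r assms by (intro rows_combs) (auto simp: rows_def)
    have dot: "dot (comb 1 r (- 1) q) (1 # y) = dot r (1 # y) - dot q (1 # y)"
      if "q \<in> set Q" "y \<in> nonneg_vecs n" for q y
      using that r assms by (subst dot_comb) (auto simp: rows_def nonneg_vecs_def)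
    have "infeasible (Suc n) (combs 1 r (- 1) Q) \<longleftrightarrow>
        \<not> (\<exists>y\<in>nonneg_vecs n. \<forall>s\<in>set (combs 1 r (- 1) Q). 0 < dot s (1 # y))"
      unfolding infeasible_iff[OF rws]
    proof (intro arg_cong[of _ _ Not] iffI)
      assume "\<exists>y\<in>nonneg_vecs n. \<forall>s\<in>set (combs 1 r (- 1) Q). 0 < dot s (1 # y)"
      then obtain y where "y \<in> nonneg_vecs n" "\<forall>s\<in>set (combs 1 r (- 1) Q). 0 < dot s (1 # y)"
        by blast
      then show "\<exists>y\<in>nonneg_vecs (Suc n). \<forall>s\<in>set (combs 1 r (- 1) Q). 0 < dot s y"
        by (intro bexI[of _ "1 # y"]) (auto simp: nonneg_vecs_def)
    qed (use positive_homogenize[OF rws] in blast)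
    then show ?thesis using dot by (auto simp: combs_def not_less)
  qed
  then show ?thesis unfolding dominated_def by blast
qed

section \<open>Computable form of the machine semantics\<close>

text \<open>Calls are not unfolded by \<open>run\<close>: they consult the relation \<open>eval\<close>, so that the simplifier can
  execute a single function body.\<close>

definition call :: "program \<Rightarrow> nat \<Rightarrow> data list \<Rightarrow> (data \<times> nat) option" where
  "call P f vs =
     (if f < length P \<and> (\<exists>v t. eval P vs (P ! f) v t)
      then Some (SOME (v, t). eval P vs (P ! f) v t) else None)"

fun run :: "program \<Rightarrow> data list \<Rightarrow> expr \<Rightarrow> (data \<times> nat) option"
  and run_list :: "program \<Rightarrow> data list \<Rightarrow> expr list \<Rightarrow> (data list \<times> nat) option" where
  "run P env (Arg i) = (if i < length env then Some (env ! i, 1) else None)"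
| "run P env NilE = Some (DNil, 1)"
| "run P env (IntE c) = Some (DNum (of_int c), 1)"
| "run P env (PairE a b) = (case run P env a of Some (u, s) \<Rightarrow>
     (case run P env b of Some (v, t) \<Rightarrow> Some (DPair u v, s + t + 1) | None \<Rightarrow> None) | None \<Rightarrow> None)"
| "run P env (FstE a) = (case run P env a of Some (DPair u v, t) \<Rightarrow> Some (u, t + 1) | _ \<Rightarrow> None)"
| "run P env (SndE a) = (case run P env a of Some (DPair u v, t) \<Rightarrow> Some (v, t + 1) | _ \<Rightarrow> None)"
| "run P env (AddE a b) = (case run P env a of Some (DNum x, s) \<Rightarrow>
     (case run P env b of Some (DNum y, t) \<Rightarrow> Some (DNum (x + y), s + t + 1) | _ \<Rightarrow> None) | _ \<Rightarrow> None)"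
| "run P env (SubE a b) = (case run P env a of Some (DNum x, s) \<Rightarrow>
     (case run P env b of Some (DNum y, t) \<Rightarrow> Some (DNum (x - y), s + t + 1) | _ \<Rightarrow> None) | _ \<Rightarrow> None)"
| "run P env (MulE a b) = (case run P env a of Some (DNum x, s) \<Rightarrow>
     (case run P env b of Some (DNum y, t) \<Rightarrow> Some (DNum (x * y), s + t + 1) | _ \<Rightarrow> None) | _ \<Rightarrow> None)"
| "run P env (IfPair a b c) = (case run P env a of Some (u, s) \<Rightarrow>
     (case (if \<exists>u1 u2. u = DPair u1 u2 then run P env b else run P env c) of
        Some (v, t) \<Rightarrow> Some (v, s + t + 1) | None \<Rightarrow> None) | None \<Rightarrow> None)"
| "run P env (IfLess a b c e) = (case run P env a of Some (DNum x, s) \<Rightarrow>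
     (case run P env b of Some (DNum y, s') \<Rightarrow>
       (case (if x < y then run P env c else run P env e) of
          Some (v, t) \<Rightarrow> Some (v, s + s' + t + 1) | None \<Rightarrow> None) | _ \<Rightarrow> None) | _ \<Rightarrow> None)"
| "run P env (Call f es) = (case run_list P env es of Some (vs, s) \<Rightarrow>
     (case call P f vs of Some (v, t) \<Rightarrow> Some (v, s + t + 1) | None \<Rightarrow> None) | None \<Rightarrow> None)"
| "run_list P env [] = Some ([], 0)"
| "run_list P env (e # es) = (case run P env e of Some (v, s) \<Rightarrow>
     (case run_list P env es of Some (vs, t) \<Rightarrow> Some (v # vs, s + t) | None \<Rightarrow> None) | None \<Rightarrow> None)"

lemma call_SomeD:
  assumes "call P f vs = Some (v, t)"
  shows "f < length P \<and> eval P vs (P ! f) v t"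
proof -
  have "\<exists>p. case p of (v, t) \<Rightarrow> eval P vs (P ! f) v t"
    using assms by (auto simp: call_def split: if_splits)
  then have "case (SOME (v, t). eval P vs (P ! f) v t) of (v, t) \<Rightarrow> eval P vs (P ! f) v t"
    by (rule someI_ex)
  with assms show ?thesis by (auto simp: call_def split: if_splits)
qed

text \<open>Determinism of the machine identifies the pair picked by \<open>SOME\<close> with the
  given one.\<close>

lemma call_SomeI:
  assumes "f < length P" "eval P vs (P ! f) v t"
  shows "call P f vs = Some (v, t)"
proof -
  obtain v' t' where call: "call P f vs = Some (v', t')"
    using assms unfolding call_def by (metis (lifting) surj_pair)
  from call_SomeD[OF call] have "v' = v \<and> t' = t"
    using eval_evals_deterministic(1)[OF assms(2)] by blast
  with call show ?thesis by simp
qed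

lemma run_sound: "run P env e = Some (v, t) \<Longrightarrow> eval P env e v t"
proof (induction e arbitrary: v t)
  case IfPair
  then show ?case
    by (auto simp del: One_nat_def split: option.splits if_splits)
      (metis eval_IfPair_True eval_IfPair_False)+
next
  case IfLess
  then show ?case
    by (auto simp del: One_nat_def split: option.splits data.splits if_splits)
      (metis eval_IfLess_True eval_IfLess_False)+
next
  case (Call f es)
  \<comment> \<open>The hypotheses cover single arguments; the version for argument lists needs its
    own induction.\<close>
  have "run_list P env es = Some (vs, s) \<Longrightarrow> evals P env es vs s" for vs s
    using Call.IH by (induction es arbitrary: vs s) (auto split: option.splits intro!: evals_Nil evals_Cons)
  with Call.prems show ?case
    by (auto simp del: One_nat_def split: option.splits intro: eval_Call dest!: call_SomeD)
qed (auto simp del: One_nat_def split: option.splits data.splits if_splits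
    intro!: eval_evals.intros)

text \<open>The way from a body to a call: simplification of \<open>run\<close> on the body leaves
  only inner calls, whose values come from induction hypotheses and earlier results.\<close>

lemma call_eqI:
  "f < length P \<Longrightarrow> run P vs (P ! f) = Some (v, t) \<Longrightarrow> call P f vs = Some (v, t)"
  by (rule call_SomeI) (auto dest: run_sound)

section \<open>The program\<close>

text \<open>The numbers are positions in \<open>prog\<close>; they are fixed before the bodies
  because these are mutually recursive.\<close>

abbreviation "call_table tab \<equiv> Call 1 [tab]"
abbreviation "call_comb a p b q \<equiv> Call 2 [a, p, b, q]"
abbreviation "call_combs a p b S \<equiv> Call 3 [a, p, b, S]"
abbreviation "call_cross a Q S \<equiv> Call 4 [a, Q, S]"
abbreviation "call_lincomb as Es b \<equiv> Call 5 [as, Es, b]"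
abbreviation "call_subst_rows Q Es z \<equiv> Call 6 [Q, Es, z]"
abbreviation "call_point ys x \<equiv> Call 7 [ys, x]"
abbreviation "call_lookup f tab \<equiv> Call 8 [f, tab]"
abbreviation "call_expand t tab xs \<equiv> Call 9 [t, tab, xs]"
abbreviation "call_expands ts tab xs \<equiv> Call 10 [ts, tab, xs]"
abbreviation "call_occs t \<equiv> Call 11 [t]"
abbreviation "call_occs_list ts \<equiv> Call 12 [ts]"
abbreviation "call_elim_row a p T \<equiv> Call 13 [a, p, T]"
abbreviation "call_elim S T \<equiv> Call 14 [S, T]"
abbreviation "call_infeasible S \<equiv> Call 15 [S]"
abbreviation "call_dominated P Q \<equiv> Call 16 [P, Q]"
abbreviation "call_rules rs tab \<equiv> Call 17 [rs, tab]"
abbreviation "call_iota r i \<equiv> Call 18 [r, i]"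
abbreviation "call_unit_rows ys xs \<equiv> Call 19 [ys, xs]"
abbreviation "call_append x y \<equiv> Call 20 [x, y]"

text \<open>Truth values are the numbers 0 and 1, so conjunction is multiplication.\<close>

definition main_body :: expr where
  "main_body = MulE (call_table (SndE (Arg 0))) (call_rules (SndE (SndE (FstE (Arg 0)))) (SndE (Arg 0)))"

text \<open>The table does not store arities. The arity is read off from the tail of the first row
  of \<open>Q\<close>, which exists because normal forms are nonempty. \<open>let\<close> is
  expanded by HOL, so the machine evaluates \<open>xs\<close> twice.\<close>

definition table_body :: expr where
  "table_body = IfPair (Arg 0)
     (MulE
       (let Q = SndE (FstE (Arg 0)); xs = call_iota (SndE (FstE Q)) (IntE 0)
        in call_dominated (call_unit_rows xs xs) Q)
       (call_table (SndE (Arg 0))))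
     (IntE 1)"

definition comb_body :: expr where
  "comb_body = IfPair (Arg 1)
     (PairE (AddE (MulE (Arg 0) (FstE (Arg 1))) (MulE (Arg 2) (FstE (Arg 3))))
       (call_comb (Arg 0) (SndE (Arg 1)) (Arg 2) (SndE (Arg 3))))
     NilE"

definition combs_body :: expr where
  "combs_body = IfPair (Arg 3)
     (PairE (call_comb (Arg 0) (Arg 1) (Arg 2) (FstE (Arg 3)))
       (call_combs (Arg 0) (Arg 1) (Arg 2) (SndE (Arg 3))))
     NilE"

definition cross_body :: expr where
  "cross_body = IfPair (Arg 1)
     (call_append (call_combs (Arg 0) (FstE (Arg 1)) (IntE 1) (Arg 2))
       (call_cross (Arg 0) (SndE (Arg 1)) (Arg 2)))
     NilE"

definition lincomb_body :: expr where
  "lincomb_body = IfPair (Arg 0)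
     (call_cross (FstE (Arg 0)) (FstE (Arg 1)) (call_lincomb (SndE (Arg 0)) (SndE (Arg 1)) (Arg 2)))
     (PairE (Arg 2) NilE)"

definition subst_rows_body :: expr where
  "subst_rows_body = IfPair (Arg 0)
     (call_append
       (call_lincomb (SndE (FstE (Arg 0))) (Arg 1) (PairE (FstE (FstE (Arg 0))) (Arg 2)))
       (call_subst_rows (SndE (Arg 0)) (Arg 1) (Arg 2)))
     NilE"

text \<open>The machine has no equality test; two order tests replace it.\<close>

definition point_body :: expr where
  "point_body = IfPair (Arg 0)
     (PairE
       (IfLess (FstE (Arg 0)) (Arg 1) (IntE 0) (IfLess (Arg 1) (FstE (Arg 0)) (IntE 0) (IntE 1)))
       (call_point (SndE (Arg 0)) (Arg 1)))
     NilE"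

text \<open>There is no branch for an exhausted table, since only symbols listed in it are looked
  up.\<close>

definition lookup_body :: expr where
  "lookup_body =
     (let g = FstE (FstE (Arg 1)); continue = call_lookup (Arg 0) (SndE (Arg 1))
      in IfLess (Arg 0) g continue (IfLess g (Arg 0) continue (SndE (FstE (Arg 1)))))"

definition expand_body :: expr where
  "expand_body = IfLess (FstE (Arg 0)) (IntE 1)
     (PairE (PairE (IntE 0) (call_point (Arg 2) (SndE (Arg 0)))) NilE)
     (call_subst_rows (call_lookup (FstE (SndE (Arg 0))) (Arg 1))
       (call_expands (SndE (SndE (Arg 0))) (Arg 1) (Arg 2))
       (call_point (Arg 2) (IntE (- 1))))"

definition expands_body :: expr where
  "expands_body = IfPair (Arg 0)
     (PairE (call_expand (FstE (Arg 0)) (Arg 1) (Arg 2)) (call_expands (SndE (Arg 0)) (Arg 1) (Arg 2)))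
     NilE"

definition occs_body :: expr where
  "occs_body = IfLess (FstE (Arg 0)) (IntE 1)
     (PairE (SndE (Arg 0)) NilE) (call_occs_list (SndE (SndE (Arg 0))))"

definition occs_list_body :: expr where
  "occs_list_body = IfPair (Arg 0)
     (call_append (call_occs (FstE (Arg 0))) (call_occs_list (SndE (Arg 0)))) NilE"

definition elim_row_body :: expr where
  "elim_row_body = IfPair (Arg 2)
     (let q = FstE (Arg 2); rest = call_elim_row (Arg 0) (Arg 1) (SndE (Arg 2))
      in IfLess (IntE 0) (FstE q)
        (PairE (call_comb (FstE q) (Arg 1) (SubE (IntE 0) (Arg 0)) (SndE q)) rest) rest)
     NilE"

definition elim_body :: expr where
  "elim_body = IfPair (Arg 0)
     (let r = FstE (Arg 0); rest = call_elim (SndE (Arg 0)) (Arg 1)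
      in IfLess (IntE 0) (FstE r) rest
        (PairE (SndE r) (call_append (call_elim_row (FstE r) (SndE r) (Arg 1)) rest)))
     NilE"

text \<open>The number of unknowns is not passed along: the first row becomes empty exactly when
  none is left. An empty system can be answered by 0 at once, as elimination keeps it empty.\<close>

definition infeasible_body :: expr where
  "infeasible_body = IfPair (Arg 0)
     (IfPair (FstE (Arg 0)) (call_infeasible (call_elim (Arg 0) (Arg 0))) (IntE 1)) (IntE 0)"

definition dominated_body :: expr where
  "dominated_body = IfPair (Arg 0)
     (MulE (call_infeasible (call_combs (IntE 1) (FstE (Arg 0)) (IntE (- 1)) (Arg 1)))
       (call_dominated (SndE (Arg 0)) (Arg 1)))
     (IntE 1)"

definition rules_body :: expr where
  "rules_body = IfPair (Arg 0)
     (MulE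
       (let l = FstE (FstE (Arg 0)); r = SndE (FstE (Arg 0)); xs = call_occs l
        in call_dominated (call_expand r (Arg 1) xs) (call_expand l (Arg 1) xs))
       (call_rules (SndE (Arg 0)) (Arg 1)))
     (IntE 1)"

text \<open>The first argument acts as a unary counter: only its length matters.\<close>

definition iota_body :: expr where
  "iota_body = IfPair (Arg 0)
     (PairE (Arg 1) (call_iota (SndE (Arg 0)) (AddE (Arg 1) (IntE 1)))) NilE"

definition unit_rows_body :: expr where
  "unit_rows_body = IfPair (Arg 0)
     (PairE (PairE (IntE 0) (call_point (Arg 1) (FstE (Arg 0))))
       (call_unit_rows (SndE (Arg 0)) (Arg 1)))
     NilE"

definition append_body :: expr where
  "append_body = IfPair (Arg 0)
     (PairE (FstE (Arg 0)) (call_append (SndE (Arg 0)) (Arg 1))) (Arg 1)"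

definition prog :: program where
  "prog = [main_body, table_body, comb_body, combs_body, cross_body, lincomb_body, subst_rows_body,
     point_body, lookup_body, expand_body, expands_body, occs_body, occs_list_body, elim_row_body,
     elim_body, infeasible_body, dominated_body, rules_body, iota_body, unit_rows_body, append_body]"

lemma prog_simps [simp]:
  "length prog = 21" "prog ! 0 = main_body" "prog ! Suc 0 = table_body" "prog ! 2 = comb_body"
  "prog ! 3 = combs_body" "prog ! 4 = cross_body" "prog ! 5 = lincomb_body"
  "prog ! 6 = subst_rows_body" "prog ! 7 = point_body" "prog ! 8 = lookup_body"
  "prog ! 9 = expand_body" "prog ! 10 = expands_body" "prog ! 11 = occs_body"
  "prog ! 12 = occs_list_body" "prog ! 13 = elim_row_body" "prog ! 14 = elim_body"
  "prog ! 15 = infeasible_body" "prog ! 16 = dominated_body" "prog ! 17 = rules_body"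
  "prog ! 18 = iota_body" "prog ! 19 = unit_rows_body" "prog ! 20 = append_body"
  by (simp_all add: prog_def)

text \<open>Result and time in one statement. The time is merely bounded, so constants can be
  rounded up.\<close>

definition computes :: "nat \<Rightarrow> data list \<Rightarrow> data \<Rightarrow> nat \<Rightarrow> bool" where
  "computes f vs v B \<longleftrightarrow> (\<exists>t\<le>B. call prog f vs = Some (v, t))"

lemma computesI:
  "f < 21 \<Longrightarrow> \<exists>t\<le>B. run prog vs (prog ! f) = Some (v, t) \<Longrightarrow> computes f vs v B"
  unfolding computes_def using call_eqI[of f prog vs v] by auto

lemma computesE:
  assumes "computes f vs v B"
  obtains t where "call prog f vs = Some (v, t)" "t \<le> B"
  using assms by (auto simp: computes_def)

lemma computes_mono: "computes f vs v B \<Longrightarrow> B \<le> B' \<Longrightarrow> computes f vs v B'"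
  unfolding computes_def by (meson order_trans)

abbreviation "enc_row r \<equiv> enc_list (map DNum r)"

section \<open>Running times of the basic row operations\<close>

lemma enc_maxplus_simps [simp]:
  "enc_maxplus [] = DNil" "enc_maxplus (r # Q) = DPair (enc_row r) (enc_maxplus Q)"
  by (simp_all add: enc_maxplus_def)

text \<open>One round of the loop costs 9 steps and the final test 3. The same exact count gives the
  19 for \<open>comb\<close>; most later constants are rounded up.\<close>

lemma computes_append:
  "computes 20 [enc_list xs, enc_list ys] (enc_list (xs @ ys)) (9 * length xs + 3)"
proof (induction xs)
  case Nil
  show ?case by (rule computesI) (simp_all add: append_body_def)
next
  case (Cons x xs)
  obtain t where "call prog 20 [enc_list xs, enc_list ys] = Some (enc_list (xs @ ys), t)"
    "t \<le> 9 * length xs + 3" using Cons by (elim computesE)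
  then show ?case by (intro computesI) (simp_all add: append_body_def)
qed

lemma computes_append_rows:
  "computes 20 [enc_maxplus S, enc_maxplus T] (enc_maxplus (S @ T)) (9 * length S + 3)"
  using computes_append[of "map enc_row S" "map enc_row T"] by (simp add: enc_maxplus_def)

lemma computes_comb:
  "length p = length q \<Longrightarrow>
   computes 2 [DNum a, enc_row p, DNum b, enc_row q] (enc_row (comb a p b q)) (19 * length p + 3)"
proof (induction p q rule: list_induct2)
  case Nil
  show ?case by (rule computesI) (simp_all add: comb_body_def)
next
  case (Cons x p y q)
  from Cons(2) obtain t
    where "call prog 2 [DNum a, enc_row p, DNum b, enc_row q] = Some (enc_row (comb a p b q), t)"
    "t \<le> 19 * length p + 3" by (elim computesE)
  then show ?case by (intro computesI) (simp_all add: comb_body_def)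
qed

lemma computes_combs:
  assumes "length p = m" "rows m S"
  shows "computes 3 [DNum a, enc_row p, DNum b, enc_maxplus S] (enc_maxplus (combs a p b S))
    ((19 * m + 30) * length S + 3)"
  using assms(2)
proof (induction S)
  case Nil
  show ?case by (rule computesI) (simp_all add: combs_body_def)
next
  case (Cons q S)
  then obtain t where "call prog 3 [DNum a, enc_row p, DNum b, enc_maxplus S] =
      Some (enc_maxplus (combs a p b S), t)" "t \<le> (19 * m + 30) * length S + 3"
    by (auto elim: computesE)
  moreover obtain s where "call prog 2 [DNum a, enc_row p, DNum b, enc_row q] =
      Some (enc_row (comb a p b q), s)" "s \<le> 19 * m + 3"
    using computes_comb[of p q a b] Cons.prems assms by (auto elim: computesE)
  ultimately show ?case by (intro computesI) (simp_all add: combs_body_def)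
qed

text \<open>Each row of \<open>Q\<close> costs \<open>19 * m + 30\<close> per row of
  \<open>S\<close> for the combination and 9 for appending, together below
  \<open>19 * m + 40\<close>.\<close>

lemma computes_cross:
  assumes "rows m Q" "rows m S"
  shows "computes 4 [DNum a, enc_maxplus Q, enc_maxplus S] (enc_maxplus (cross a Q S))
    (length Q * ((19 * m + 40) * length S + 40) + 3)"
  using assms(1)
proof (induction Q)
  case Nil
  show ?case by (rule computesI) (simp_all add: cross_body_def)
next
  case (Cons q Q)
  then obtain t where "call prog 4 [DNum a, enc_maxplus Q, enc_maxplus S] =
      Some (enc_maxplus (cross a Q S), t)" "t \<le> length Q * ((19 * m + 40) * length S + 40) + 3"
    by (auto elim: computesE)
  moreover obtain s where "call prog 3 [DNum a, enc_row q, DNum 1, enc_maxplus S] =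
      Some (enc_maxplus (combs a q 1 S), s)" "s \<le> (19 * m + 30) * length S + 3"
    using computes_combs[of q m S a 1] Cons.prems assms by (auto elim: computesE)
  moreover obtain u where "call prog 20 [enc_maxplus (combs a q 1 S), enc_maxplus (cross a Q S)] =
      Some (enc_maxplus (cross a (q # Q) S), u)" "u \<le> 9 * length S + 3"
    using computes_append_rows[of "combs a q 1 S" "cross a Q S"] by (auto elim: computesE)
  ultimately show ?case
    by (intro computesI) (simp_all add: cross_body_def algebra_simps)
qed

section \<open>Polynomially bounded functions\<close>

text \<open>The base is at least 2 for every \<open>k\<close>, so constants and factors are absorbed
  by the exponent, and a single number describes the bound.\<close>

definition poly_bounded :: "(nat \<Rightarrow> nat) \<Rightarrow> bool" where
  "poly_bounded B \<longleftrightarrow> (\<exists>e. \<forall>k. B k \<le> (k + 2) ^ e)"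

lemma poly_bounded_const: "poly_bounded (\<lambda>_. c)"
proof -
  have "c \<le> (k + 2) ^ c" for k
  proof -
    have "c \<le> 2 ^ c" using less_exp[of c] by linarith
    also have "\<dots> \<le> (k + 2) ^ c" by (intro power_mono) auto
    finally show ?thesis .
  qed
  then show ?thesis unfolding poly_bounded_def by blast
qed

lemma poly_bounded_id: "poly_bounded (\<lambda>k. k)"
  unfolding poly_bounded_def by (intro exI[of _ 1]) auto

lemma poly_bounded_add:
  assumes "poly_bounded B" "poly_bounded C"
  shows "poly_bounded (\<lambda>k. B k + C k)"
proof -
  obtain d e where B: "\<And>k. B k \<le> (k + 2) ^ d" and C: "\<And>k. C k \<le> (k + 2) ^ e"
    using assms unfolding poly_bounded_def by blast
  have "B k + C k \<le> (k + 2) ^ (d + e + 1)" for k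
  proof -
    have "B k \<le> (k + 2) ^ (d + e)" "C k \<le> (k + 2) ^ (d + e)"
      using B[of k] C[of k] power_increasing[of d "d + e" "k + 2"]
        power_increasing[of e "d + e" "k + 2"] by linarith+
    then have "B k + C k \<le> 2 * (k + 2) ^ (d + e)" by linarith
    also have "\<dots> \<le> (k + 2) * (k + 2) ^ (d + e)" by (intro mult_right_mono) auto
    finally show ?thesis by simp
  qed
  then show ?thesis unfolding poly_bounded_def by blast
qed

lemma poly_bounded_mult:
  assumes "poly_bounded B" "poly_bounded C"
  shows "poly_bounded (\<lambda>k. B k * C k)"
proof -
  obtain d e where "\<And>k. B k \<le> (k + 2) ^ d" "\<And>k. C k \<le> (k + 2) ^ e"
    using assms unfolding poly_bounded_def by blast
  then have "B k * C k \<le> (k + 2) ^ (d + e)" for k by (simp add: power_add mult_le_mono)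
  then show ?thesis unfolding poly_bounded_def by blast
qed

lemma poly_bounded_power: "poly_bounded B \<Longrightarrow> poly_bounded (\<lambda>k. B k ^ j)"
  by (induction j) (simp_all add: poly_bounded_const poly_bounded_mult)

lemma poly_bounded_mono: "poly_bounded B \<Longrightarrow> (\<And>k. C k \<le> B k) \<Longrightarrow> poly_bounded C"
  unfolding poly_bounded_def by (meson order_trans)

lemmas poly_bounded_intros = poly_bounded_const poly_bounded_id poly_bounded_add
  poly_bounded_mult poly_bounded_power

text \<open>The majorant of \<open>B\<close> holds at every argument, hence also at
  \<open>C k\<close>, for instance the size of a system after an elimination step.\<close>

lemma poly_bounded_comp:
  assumes "poly_bounded B" "poly_bounded C"
  shows "poly_bounded (\<lambda>k. B (C k))"
proof -
  obtain e where "\<And>k. B k \<le> (k + 2) ^ e" using assms unfolding poly_bounded_def by blast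
  then have "B (C k) \<le> (C k + 2) ^ e" for k .
  moreover have "poly_bounded (\<lambda>k. (C k + 2) ^ e)"
    by (intro poly_bounded_power poly_bounded_add assms(2) poly_bounded_const)
  ultimately show ?thesis by (rule poly_bounded_mono[rotated])
qed

section \<open>Running times\<close>

primrec lincomb_cost :: "nat \<Rightarrow> nat \<Rightarrow> nat \<Rightarrow> nat" where
  "lincomb_cost m N 0 = 10"
| "lincomb_cost m N (Suc j) = lincomb_cost m N j + N * ((19 * m + 40) * N ^ j + 40) + 30"

lemma poly_bounded_lincomb_cost: "poly_bounded B \<Longrightarrow> poly_bounded (\<lambda>k. lincomb_cost m (B k) j)"
  by (induction j) (unfold lincomb_cost.simps, (assumption | intro poly_bounded_intros)+)

text \<open>Every argument multiplies the number of rows by at most \<open>N\<close>. The exponent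
  is an arity, so the growth is polynomial in \<open>N\<close>.\<close>

lemma length_lincomb:
  "length as = length Es \<Longrightarrow> (\<And>E. E \<in> set Es \<Longrightarrow> length E \<le> N) \<Longrightarrow>
   length (lincomb as Es b) \<le> N ^ length Es"
  by (induction as Es b rule: lincomb.induct) (auto intro!: mult_le_mono)

abbreviation "enc_rows_list Es \<equiv> enc_list (map enc_maxplus Es)"

lemma computes_lincomb:
  "length as = length Es \<Longrightarrow> length b = m \<Longrightarrow> \<forall>E\<in>set Es. rows m E \<and> length E \<le> N \<Longrightarrow>
   computes 5 [enc_row as, enc_rows_list Es, enc_row b] (enc_maxplus (lincomb as Es b))
     (lincomb_cost m N (length Es))"
proof (induction as Es rule: list_induct2)
  case Nil
  show ?case by (rule computesI) (simp_all add: lincomb_body_def)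
next
  case (Cons a as E Es)
  let ?L = "lincomb as Es b"
  obtain t where t: "call prog 5 [enc_row as, enc_rows_list Es, enc_row b] =
      Some (enc_maxplus ?L, t)" "t \<le> lincomb_cost m N (length Es)"
    using Cons by (auto elim: computesE)
  have "rows m ?L" using Cons.prems by (intro rows_lincomb) auto
  then obtain s where s: "call prog 4 [DNum a, enc_maxplus E, enc_maxplus ?L] =
      Some (enc_maxplus (cross a E ?L), s)"
    "s \<le> length E * ((19 * m + 40) * length ?L + 40) + 3"
    using computes_cross[of m E ?L a] Cons.prems by (auto elim: computesE)
  have "length ?L \<le> N ^ length Es" "length E \<le> N"
    using Cons by (auto intro: length_lincomb)
  then have "length E * ((19 * m + 40) * length ?L + 40) \<le> N * ((19 * m + 40) * N ^ length Es + 40)"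
    by (intro mult_le_mono add_mono) auto
  with s(2) t(2) have "s + t + 30 \<le> lincomb_cost m N (Suc (length Es)) + 3" by simp
  with s(1) t(1) show ?case
    by (intro computesI) (simp_all add: lincomb_body_def)
qed

definition subst_rows_cost :: "nat \<Rightarrow> nat \<Rightarrow> nat \<Rightarrow> nat \<Rightarrow> nat" where
  "subst_rows_cost m N j k = k * (lincomb_cost (Suc m) N j + 9 * N ^ j + 50) + 3"

lemma poly_bounded_subst_rows_cost:
  "poly_bounded B \<Longrightarrow> poly_bounded C \<Longrightarrow> poly_bounded (\<lambda>k. subst_rows_cost m (B k) j (C k))"
  unfolding subst_rows_cost_def by (intro poly_bounded_intros poly_bounded_lincomb_cost)

lemma length_subst_rows:
  assumes "rows (Suc (length Es)) Q" "\<And>E. E \<in> set Es \<Longrightarrow> length E \<le> N"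
  shows "length (subst_rows Q Es z) \<le> length Q * N ^ length Es"
  using assms(1)
proof (induction Q)
  case (Cons r Q)
  then have "length (lincomb (tl r) Es (hd r # z)) \<le> N ^ length Es"
    using assms(2) by (intro length_lincomb) auto
  with Cons show ?case by auto
qed simp

lemma computes_subst_rows:
  assumes "rows (Suc (length Es)) Q" "length z = m"
    "\<forall>E\<in>set Es. rows (Suc m) E \<and> length E \<le> N"
  shows "computes 6 [enc_maxplus Q, enc_rows_list Es, enc_row z] (enc_maxplus (subst_rows Q Es z))
    (subst_rows_cost m N (length Es) (length Q))"
  using assms(1)
proof (induction Q)
  case Nil
  show ?case by (rule computesI) (simp_all add: subst_rows_body_def subst_rows_cost_def)
next
  case (Cons r Q)
  then obtain a as where r: "r = a # as" "length as = length Es" by (cases r) auto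
  let ?L = "lincomb as Es (a # z)"
  obtain t where t: "call prog 6 [enc_maxplus Q, enc_rows_list Es, enc_row z] =
      Some (enc_maxplus (subst_rows Q Es z), t)" "t \<le> subst_rows_cost m N (length Es) (length Q)"
    using Cons by (auto elim: computesE)
  obtain s where s: "call prog 5 [enc_row as, enc_rows_list Es, DPair (DNum a) (enc_row z)] =
      Some (enc_maxplus ?L, s)" "s \<le> lincomb_cost (Suc m) N (length Es)"
    using computes_lincomb[OF r(2), of "a # z" "Suc m" N] assms by (auto elim: computesE)
  obtain u where u: "call prog 20 [enc_maxplus ?L, enc_maxplus (subst_rows Q Es z)] =
      Some (enc_maxplus (?L @ subst_rows Q Es z), u)" "u \<le> 9 * length ?L + 3"
    using computes_append_rows[of ?L "subst_rows Q Es z"] by (auto elim: computesE)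
  have "length ?L \<le> N ^ length Es" using r assms by (intro length_lincomb) auto
  with s t u r show ?case
    by (intro computesI) (simp_all add: subst_rows_body_def subst_rows_cost_def)
qed

section \<open>Running time of the expansion of terms\<close>

lemma computes_point:
  "computes 7 [enc_row ys, DNum x] (enc_row (point ys x)) (30 * length ys + 3)"
proof (induction ys)
  case Nil
  show ?case by (rule computesI) (simp_all add: point_body_def)
next
  case (Cons y ys)
  then obtain t where "call prog 7 [enc_row ys, DNum x] = Some (enc_row (point ys x), t)"
    "t \<le> 30 * length ys + 3" by (auto elim: computesE)
  then show ?case
    by (cases y x rule: linorder_cases) (intro computesI; simp add: point_body_def)+
qed

text \<open>\<open>enc_table\<close> with the list of symbols as a parameter, which allows induction
  over that list.\<close>

abbreviation enc_assoc :: "(nat \<Rightarrow> maxplus) \<Rightarrow> signature \<Rightarrow> data" where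
  "enc_assoc A S \<equiv> enc_list (map (\<lambda>(f, n). DPair (enc_nat f) (enc_maxplus (A f))) S)"

lemma computes_lookup:
  "f \<in> fst ` set S \<Longrightarrow>
   computes 8 [enc_nat f, enc_assoc A S] (enc_maxplus (A f)) (30 * length S)"
proof (induction S)
  case (Cons p S)
  obtain g n where p: "p = (g, n)" by (cases p)
  show ?case
  proof (cases "f = g")
    case True
    then show ?thesis
      by (intro computesI) (simp_all add: lookup_body_def Let_def p enc_nat_def)
  next
    case False
    with Cons p obtain t where "call prog 8 [enc_nat f, enc_assoc A S] = Some (enc_maxplus (A f), t)"
      "t \<le> 30 * length S" by (auto elim: computesE)
    with False show ?thesis
      by (cases f g rule: linorder_cases; intro computesI)
        (simp_all add: lookup_body_def Let_def p enc_nat_def)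
  qed
qed simp

text \<open>The input is a term of the fixed system, independent of \<open>k\<close> and the table,
  so any constant bound will do.\<close>

lemma computes_occs:
  "\<exists>B. computes 11 [enc_trm t] (enc_row (map real (var_occs t))) B"
proof (induction t)
  case (Var x)
  have "computes 11 [enc_trm (Var x)] (enc_row (map real (var_occs (Var x)))) 30"
    by (rule computesI) (simp_all add: occs_body_def enc_nat_def)
  then show ?case by blast
next
  case (Fun f ts)
  have "\<exists>B. computes 12 [enc_list (map enc_trm ts)]
      (enc_row (map real (concat (map var_occs ts)))) B"
    using Fun
  proof (induction ts)
    case Nil
    have "computes 12 [enc_list (map enc_trm [])] (enc_row (map real (concat (map var_occs [])))) 30"
      by (rule computesI) (simp_all add: occs_list_body_def)
    then show ?case by blast
  next
    case (Cons t ts)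
    have "\<exists>C. computes 11 [enc_trm t] (enc_row (map real (var_occs t))) C"
      by (rule Cons.prems) simp
    moreover have "\<exists>B. computes 12 [enc_list (map enc_trm ts)]
        (enc_row (map real (concat (map var_occs ts)))) B"
      by (rule Cons.IH) (rule Cons.prems, simp)
    ultimately obtain B C where "computes 12 [enc_list (map enc_trm ts)]
        (enc_row (map real (concat (map var_occs ts)))) B"
      "computes 11 [enc_trm t] (enc_row (map real (var_occs t))) C" by blast
    then obtain s u where su: "call prog 12 [enc_list (map enc_trm ts)] =
        Some (enc_row (map real (concat (map var_occs ts))), s)"
      "call prog 11 [enc_trm t] = Some (enc_row (map real (var_occs t)), u)"
      by (elim computesE)
    let ?xs = "map (DNum \<circ> real) (var_occs t)"
    let ?ys = "map (DNum \<circ> real) (concat (map var_occs ts))"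
    obtain w where w: "call prog 20 [enc_list ?xs, enc_list ?ys] = Some (enc_list (?xs @ ?ys), w)"
      using computes_append[of ?xs ?ys] by (auto elim: computesE)
    have "computes 12 [enc_list (map enc_trm (t # ts))]
        (enc_row (map real (concat (map var_occs (t # ts))))) (s + u + w + 30)"
      using su w by (intro computesI) (simp_all add: occs_list_body_def)
    then show ?case by blast
  qed
  then obtain B where "computes 12 [enc_list (map enc_trm ts)]
      (enc_row (map real (concat (map var_occs ts)))) B" by blast
  then obtain s where "call prog 12 [enc_list (map enc_trm ts)] =
      Some (enc_row (map real (concat (map var_occs ts))), s)" by (elim computesE)
  then have "computes 11 [enc_trm (Fun f ts)] (enc_row (map real (var_occs (Fun f ts)))) (s + 30)"
    by (intro computesI) (simp_all add: occs_body_def)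
  then show ?case by blast
qed

text \<open>The part of the assumptions on which running times depend: the shape of the table,
  without the functions that it represents.\<close>

definition valid_table :: "signature \<Rightarrow> nat \<Rightarrow> (nat \<Rightarrow> maxplus) \<Rightarrow> bool" where
  "valid_table S k A \<longleftrightarrow> (\<forall>(f, n)\<in>set S. normal_form n (A f) \<and> length (A f) \<le> k)"

lemma normal_form_rows: "normal_form n Q \<Longrightarrow> rows (Suc n) Q"
  by (simp add: normal_form_def rows_def)

text \<open>The assumption is the induction hypothesis of the result for single terms. The same
  \<open>B\<close> bounds the time and the number of rows.\<close>

lemma computes_expands:
  assumes "\<And>t. t \<in> set ts \<Longrightarrow> \<exists>B. poly_bounded B \<and> (\<forall>k A. valid_table S k A \<longrightarrow>
      computes 9 [enc_trm t, enc_assoc A S, enc_row (map real xs)] (enc_maxplus (expand A xs t)) (B k) \<and>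
      length (expand A xs t) \<le> B k)"
  shows "\<exists>B. poly_bounded B \<and> (\<forall>k A. valid_table S k A \<longrightarrow>
     computes 10 [enc_list (map enc_trm ts), enc_assoc A S, enc_row (map real xs)]
       (enc_rows_list (map (expand A xs) ts)) (B k) \<and>
     (\<forall>t\<in>set ts. length (expand A xs t) \<le> B k))"
  using assms
proof (induction ts)
  case Nil
  have "computes 10 [enc_list (map enc_trm []), enc_assoc A S, enc_row (map real xs)]
    (enc_rows_list (map (expand A xs) [])) 10" for A
    by (rule computesI) (simp_all add: expands_body_def)
  then show ?case by (intro exI[of _ "\<lambda>_. 10"]) (auto simp: poly_bounded_const)
next
  case (Cons t ts)
  obtain B where B: "poly_bounded B" "\<And>k A. valid_table S k A \<Longrightarrow>
      computes 9 [enc_trm t, enc_assoc A S, enc_row (map real xs)] (enc_maxplus (expand A xs t)) (B k)"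
    "\<And>k A. valid_table S k A \<Longrightarrow> length (expand A xs t) \<le> B k"
    using Cons.prems[of t] by force
  obtain C where C: "poly_bounded C" "\<And>k A. valid_table S k A \<Longrightarrow>
      computes 10 [enc_list (map enc_trm ts), enc_assoc A S, enc_row (map real xs)]
        (enc_rows_list (map (expand A xs) ts)) (C k)"
    "\<And>k A t. valid_table S k A \<Longrightarrow> t \<in> set ts \<Longrightarrow> length (expand A xs t) \<le> C k"
    using Cons.IH[OF Cons.prems] by force
  have "computes 10 [enc_list (map enc_trm (t # ts)), enc_assoc A S, enc_row (map real xs)]
        (enc_rows_list (map (expand A xs) (t # ts))) (B k + C k + 50)"
    if val: "valid_table S k A" for k A
  proof -
    obtain s where "call prog 9 [enc_trm t, enc_assoc A S, enc_row (map real xs)] =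
        Some (enc_maxplus (expand A xs t), s)" "s \<le> B k"
      using B(2)[OF val] by (elim computesE)
    moreover obtain u
      where "call prog 10 [enc_list (map enc_trm ts), enc_assoc A S, enc_row (map real xs)] =
        Some (enc_rows_list (map (expand A xs) ts), u)" "u \<le> C k"
      using C(2)[OF val] by (elim computesE)
    ultimately show ?thesis by (intro computesI) (simp_all add: expands_body_def)
  qed
  moreover have "poly_bounded (\<lambda>k. B k + C k + 50)" by (intro poly_bounded_intros B C)
  moreover have "length (expand A xs u) \<le> B k + C k + 50"
    if "valid_table S k A" "u \<in> set (t # ts)" for k A u
    using B(3)[OF that(1)] C(3)[OF that(1), of u] that(2) by fastforce
  ultimately show ?case by (intro exI[of _ "\<lambda>k. B k + C k + 50"]) blast
qed

text \<open>If the arguments of an n-ary symbol have at most \<open>B k\<close> rows, the term has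
  at most \<open>k * B k ^ n\<close>. Polynomial bounds are closed under this step, and the term
  alone determines how often it is taken.\<close>

lemma computes_expand:
  "wf_term S t \<Longrightarrow> \<exists>B. poly_bounded B \<and> (\<forall>k A. valid_table S k A \<longrightarrow>
     computes 9 [enc_trm t, enc_assoc A S, enc_row (map real xs)] (enc_maxplus (expand A xs t)) (B k) \<and>
     length (expand A xs t) \<le> B k)"
proof (induction t)
  case (Var x)
  obtain s where s: "call prog 7 [enc_row (map real xs), DNum (real x)] =
      Some (enc_row (point (map real xs) (real x)), s)" "s \<le> 30 * length xs + 3"
    using computes_point[of "map real xs" "real x"] by (auto elim: computesE)
  then have "computes 9 [enc_trm (Var x), enc_assoc A S, enc_row (map real xs)]
      (enc_maxplus (expand A xs (Var x))) (30 * length xs + 50)" for A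
    by (intro computesI) (simp_all add: expand_body_def enc_nat_def)
  then show ?case by (intro exI[of _ "\<lambda>_. 30 * length xs + 50"]) (auto simp: poly_bounded_const)
next
  case (Fun f ts)
  obtain B where B: "poly_bounded B" "\<And>k A. valid_table S k A \<Longrightarrow>
        computes 10 [enc_list (map enc_trm ts), enc_assoc A S, enc_row (map real xs)]
          (enc_rows_list (map (expand A xs) ts)) (B k)"
    "\<And>k A t. valid_table S k A \<Longrightarrow> t \<in> set ts \<Longrightarrow> length (expand A xs t) \<le> B k"
    using computes_expands[of ts S xs] Fun by force
  let ?n = "length ts" and ?m = "length xs"
  \<comment> \<open>The summands pay for the substitution, the expansion of the arguments, and the
    lookup with the zero row; the last one bounds the number of rows.\<close>
  let ?C = "\<lambda>k. subst_rows_cost ?m (B k) ?n k + B k + (30 * length S + 30 * ?m + 60) + k * B k ^ ?n"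
  have "computes 9 [enc_trm (Fun f ts), enc_assoc A S, enc_row (map real xs)]
      (enc_maxplus (expand A xs (Fun f ts))) (?C k)"
    "length (expand A xs (Fun f ts)) \<le> ?C k" if val: "valid_table S k A" for k A
  proof -
    let ?Es = "map (expand A xs) ts" and ?z = "point (map real xs) (- 1)"
    have f: "(f, ?n) \<in> set S" using Fun.prems by simp
    then have nf: "rows (Suc ?n) (A f)" "length (A f) \<le> k"
      using val by (auto simp: valid_table_def intro: normal_form_rows)
    have "length (subst_rows (A f) ?Es ?z) \<le> length (A f) * B k ^ ?n"
      using length_subst_rows[of ?Es "A f" "B k" ?z] nf B(3)[OF val] by auto
    also have "\<dots> \<le> k * B k ^ ?n" using nf by (intro mult_right_mono) auto
    finally show "length (expand A xs (Fun f ts)) \<le> ?C k" by simp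
    obtain s where s: "call prog 8 [enc_nat f, enc_assoc A S] = Some (enc_maxplus (A f), s)"
      "s \<le> 30 * length S"
      using computes_lookup[of f S A] f by (force elim: computesE)
    obtain u where u: "call prog 10 [enc_list (map enc_trm ts), enc_assoc A S, enc_row (map real xs)] =
        Some (enc_rows_list ?Es, u)" "u \<le> B k"
      using B(2)[OF val] by (elim computesE)
    obtain w where w: "call prog 7 [enc_row (map real xs), DNum (- 1)] = Some (enc_row ?z, w)"
      "w \<le> 30 * ?m + 3"
      using computes_point[of "map real xs" "- 1"] by (auto elim: computesE)
    obtain q where q: "call prog 6 [enc_maxplus (A f), enc_rows_list ?Es, enc_row ?z] =
        Some (enc_maxplus (subst_rows (A f) ?Es ?z), q)"
      "q \<le> subst_rows_cost ?m (B k) ?n (length (A f))"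
      using computes_subst_rows[of ?Es "A f" ?z ?m "B k"] nf B(3)[OF val] rows_expand
      by (auto elim: computesE)
    have "q \<le> subst_rows_cost ?m (B k) ?n k"
      using q(2) nf unfolding subst_rows_cost_def by (meson add_mono_thms_linordered_semiring(3) mult_le_mono1 order_trans)
    then show "computes 9 [enc_trm (Fun f ts), enc_assoc A S, enc_row (map real xs)]
        (enc_maxplus (expand A xs (Fun f ts))) (?C k)"
      using s u w q(1) by (intro computesI) (simp_all add: expand_body_def)
  qed
  moreover have "poly_bounded ?C"
    by (intro poly_bounded_intros poly_bounded_subst_rows_cost B)
  ultimately show ?case by blast
qed

section \<open>Running time of elimination and of the comparison of row lists\<close>

lemma computes_elim_row:
  assumes "length p = m" "rows (Suc m) T"
  shows "computes 13 [DNum a, enc_row p, enc_maxplus T] (enc_maxplus (elim_row a p T))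
    (length T * (19 * m + 60) + 3)"
  using assms(2)
proof (induction T)
  case Nil
  show ?case by (rule computesI) (simp_all add: elim_row_body_def)
next
  case (Cons q T)
  then obtain b q' where q: "q = b # q'" "length q' = m" by (cases q) auto
  obtain t where t: "call prog 13 [DNum a, enc_row p, enc_maxplus T] =
      Some (enc_maxplus (elim_row a p T), t)" "t \<le> length T * (19 * m + 60) + 3"
    using Cons by (auto elim: computesE)
  obtain s where "call prog 2 [DNum b, enc_row p, DNum (- a), enc_row q'] =
      Some (enc_row (comb b p (- a) q'), s)" "s \<le> 19 * m + 3"
    using computes_comb[of p q' b "- a"] q assms by (auto elim: computesE)
  with t q show ?case
    by (cases "0 < b"; intro computesI) (simp_all add: elim_row_body_def Let_def)
qed

lemma computes_elim:
  assumes "rows (Suc m) S" "rows (Suc m) T"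
  shows "computes 14 [enc_maxplus S, enc_maxplus T] (enc_maxplus (elim S T))
    (length S * (length T * (19 * m + 80) + 80) + 3)"
  using assms(1)
proof (induction S)
  case Nil
  show ?case by (rule computesI) (simp_all add: elim_body_def)
next
  case (Cons r S)
  then obtain b p where r: "r = b # p" "length p = m" by (cases r) auto
  obtain t where t: "call prog 14 [enc_maxplus S, enc_maxplus T] = Some (enc_maxplus (elim S T), t)"
    "t \<le> length S * (length T * (19 * m + 80) + 80) + 3"
    using Cons by (auto elim: computesE)
  obtain s where s: "call prog 13 [DNum b, enc_row p, enc_maxplus T] =
      Some (enc_maxplus (elim_row b p T), s)" "s \<le> length T * (19 * m + 60) + 3"
    using computes_elim_row[of p m T b] r assms by (auto elim: computesE)
  obtain u where "call prog 20 [enc_maxplus (elim_row b p T), enc_maxplus (elim S T)] =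
      Some (enc_maxplus (elim_row b p T @ elim S T), u)" "u \<le> 9 * length (elim_row b p T) + 3"
    using computes_append_rows[of "elim_row b p T" "elim S T"] by (auto elim: computesE)
  with s t r length_elim_row[of b p T] show ?case
    by (cases "0 < b"; intro computesI) (simp_all add: elim_body_def Let_def algebra_simps)
qed

primrec infeasible_cost :: "nat \<Rightarrow> nat \<Rightarrow> nat" where
  "infeasible_cost 0 N = 20"
| "infeasible_cost (Suc m) N =
     infeasible_cost m (N * (N + 1)) + N * (N * (19 * m + 80) + 80) + 30"

text \<open>Each elimination composes the bound with N (N + 1), which doubles its degree. The number
  \<open>m\<close> of unknowns is fixed by the system, so the degree remains a constant.\<close>

lemma poly_bounded_infeasible_cost: "poly_bounded (infeasible_cost m)"
proof (induction m)
  case (Suc m)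
  show ?case unfolding infeasible_cost.simps
    by (intro poly_bounded_intros poly_bounded_comp[OF Suc])
qed (simp add: poly_bounded_const)

text \<open>\<open>N\<close> has to vary in the induction, because the eliminated system is larger
  than the original one.\<close>

lemma computes_infeasible:
  "rows m S \<Longrightarrow> length S \<le> N \<Longrightarrow>
   computes 15 [enc_maxplus S] (DNum (of_bool (infeasible m S))) (infeasible_cost m N)"
proof (induction m arbitrary: S N)
  case 0
  then show ?case
    by (cases S; intro computesI) (auto simp: infeasible_body_def)
next
  case (Suc m)
  show ?case
  proof (cases S)
    case Nil
    then show ?thesis
      by (intro computesI) (auto simp: infeasible_body_def)
  next
    case (Cons r S')
    then obtain b p where r: "r = b # p" using Suc.prems by (cases r) auto
    obtain s where s: "call prog 14 [enc_maxplus S, enc_maxplus S] = Some (enc_maxplus (elim S S), s)"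
      "s \<le> length S * (length S * (19 * m + 80) + 80) + 3"
      using computes_elim Suc.prems by (blast elim: computesE)
    have "length S * (length S * (19 * m + 80) + 80) \<le> N * (N * (19 * m + 80) + 80)"
      using Suc.prems by (intro mult_le_mono add_mono) auto
    with s(2) have s': "s \<le> N * (N * (19 * m + 80) + 80) + 3" by linarith
    have "length S * (length S + 1) \<le> N * (N + 1)"
      using Suc.prems by (intro mult_le_mono add_mono) auto
    then have "length (elim S S) \<le> N * (N + 1)" using length_elim[of S S] by linarith
    then obtain t where t: "call prog 15 [enc_maxplus (elim S S)] =
        Some (DNum (of_bool (infeasible m (elim S S))), t)" "t \<le> infeasible_cost m (N * (N + 1))"
      using Suc.IH[OF rows_elim] Suc.prems by (metis computesE)
    show ?thesis
      using s(1) t s' unfolding Cons r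
      by (intro computesI) (simp_all add: infeasible_body_def del: elim_simps)
  qed
qed

definition dominated_cost :: "nat \<Rightarrow> nat \<Rightarrow> nat \<Rightarrow> nat" where
  "dominated_cost m M N = M * ((19 * m + 30) * N + infeasible_cost m N + 50) + 3"

lemma poly_bounded_dominated_cost:
  "poly_bounded B \<Longrightarrow> poly_bounded C \<Longrightarrow> poly_bounded (\<lambda>k. dominated_cost m (B k) (C k))"
  unfolding dominated_cost_def
  by (intro poly_bounded_intros poly_bounded_comp[OF poly_bounded_infeasible_cost])

lemma computes_dominated:
  assumes "rows m P" "rows m Q" "length P \<le> M" "length Q \<le> N"
  shows "computes 16 [enc_maxplus P, enc_maxplus Q] (DNum (of_bool (dominated m P Q)))
    (dominated_cost m M N)"
proof -
  \<comment> \<open>The induction uses the exact length of \<open>P\<close>, which shrinks with each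
    recursive call; \<open>M\<close> enters afterwards by monotonicity.\<close>
  have "computes 16 [enc_maxplus P, enc_maxplus Q] (DNum (of_bool (dominated m P Q)))
    (dominated_cost m (length P) N)"
    using assms(1)
  proof (induction P)
    case Nil
    show ?case by (rule computesI) (simp_all add: dominated_body_def dominated_cost_def)
  next
    case (Cons r P)
    then obtain t where t: "call prog 16 [enc_maxplus P, enc_maxplus Q] =
        Some (DNum (of_bool (dominated m P Q)), t)" "t \<le> dominated_cost m (length P) N"
      by (auto elim: computesE)
    let ?D = "combs 1 r (- 1) Q"
    obtain s where s: "call prog 3 [DNum 1, enc_row r, DNum (- 1), enc_maxplus Q] =
        Some (enc_maxplus ?D, s)" "s \<le> (19 * m + 30) * length Q + 3"
      using computes_combs[of r m Q 1 "- 1"] Cons.prems assms by (auto elim: computesE)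
    have "(19 * m + 30) * length Q \<le> (19 * m + 30) * N" using assms by (intro mult_le_mono) auto
    with s(2) have s': "s \<le> (19 * m + 30) * N + 3" by linarith
    obtain u where "call prog 15 [enc_maxplus ?D] = Some (DNum (of_bool (infeasible m ?D)), u)"
      "u \<le> infeasible_cost m N"
      using computes_infeasible[of m ?D N] rows_combs[of r m Q] Cons.prems assms
      by (auto elim: computesE)
    with t s(1) s' show ?case
      by (intro computesI) (simp_all add: dominated_body_def dominated_cost_def of_bool_conj)
  qed
  moreover have "dominated_cost m (length P) N \<le> dominated_cost m M N"
    unfolding dominated_cost_def using assms(3) by (intro add_mono mult_le_mono) auto
  ultimately show ?thesis by (rule computes_mono)
qed

section \<open>Running time of the checks for rules and symbols\<close>

abbreviation enc_rules :: "(trm \<times> trm) list \<Rightarrow> data" where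
  "enc_rules rs \<equiv> enc_list (map (\<lambda>(l, r). DPair (enc_trm l) (enc_trm r)) rs)"

text \<open>The variables are taken in order of occurrence, which spares the program a sort;
  left-linearity makes the list free of repetitions. \<open>Suc\<close> counts the constant
  coefficient as an unknown.\<close>

definition rule_decreasing :: "(nat \<Rightarrow> maxplus) \<Rightarrow> trm \<Rightarrow> trm \<Rightarrow> bool" where
  "rule_decreasing A l r \<longleftrightarrow>
     dominated (Suc (length (var_occs l))) (expand A (var_occs l) r) (expand A (var_occs l) l)"

lemma computes_rules:
  "\<forall>(l, r)\<in>set rs. wf_term S l \<and> wf_term S r \<Longrightarrow>
   \<exists>B. poly_bounded B \<and> (\<forall>k A. valid_table S k A \<longrightarrow>
     computes 17 [enc_rules rs, enc_assoc A S]
       (DNum (of_bool (\<forall>(l, r)\<in>set rs. rule_decreasing A l r))) (B k))"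
proof (induction rs)
  case Nil
  have "computes 17 [enc_rules [], enc_assoc A S]
      (DNum (of_bool (\<forall>(l, r)\<in>set []. rule_decreasing A l r))) 10" for A
    by (rule computesI) (simp_all add: rules_body_def)
  then show ?case by (intro exI[of _ "\<lambda>_. 10"]) (auto simp: poly_bounded_const)
next
  case (Cons p rs)
  obtain l r where p: "p = (l, r)" by (cases p)
  let ?xs = "var_occs l"
  obtain B where B: "poly_bounded B" "\<And>k A. valid_table S k A \<Longrightarrow>
      computes 17 [enc_rules rs, enc_assoc A S]
        (DNum (of_bool (\<forall>(l, r)\<in>set rs. rule_decreasing A l r))) (B k)"
    using Cons by force
  obtain C where C: "poly_bounded C" "\<And>k A. valid_table S k A \<Longrightarrow>
      computes 9 [enc_trm l, enc_assoc A S, enc_row (map real ?xs)] (enc_maxplus (expand A ?xs l)) (C k)"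
    "\<And>k A. valid_table S k A \<Longrightarrow> length (expand A ?xs l) \<le> C k"
    using computes_expand[of S l ?xs] Cons.prems p by force
  obtain D where D: "poly_bounded D" "\<And>k A. valid_table S k A \<Longrightarrow>
      computes 9 [enc_trm r, enc_assoc A S, enc_row (map real ?xs)] (enc_maxplus (expand A ?xs r)) (D k)"
    "\<And>k A. valid_table S k A \<Longrightarrow> length (expand A ?xs r) \<le> D k"
    using computes_expand[of S r ?xs] Cons.prems p by force
  obtain s where s: "call prog 11 [enc_trm l] = Some (enc_row (map real ?xs), s)"
    using computes_occs[of l] by (auto elim: computesE)
  \<comment> \<open>\<open>s\<close> depends on \<open>l\<close> alone and is paid twice, since the
    variable list is recomputed for each side of the rule.\<close>
  let ?E = "\<lambda>k. B k + C k + D k + dominated_cost (Suc (length ?xs)) (D k) (C k) + (2 * s + 80)"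
  have "computes 17 [enc_rules (p # rs), enc_assoc A S]
      (DNum (of_bool (\<forall>(l, r)\<in>set (p # rs). rule_decreasing A l r))) (?E k)"
    if val: "valid_table S k A" for k A
  proof -
    obtain t1 where t1: "call prog 17 [enc_rules rs, enc_assoc A S] =
        Some (DNum (of_bool (\<forall>(l, r)\<in>set rs. rule_decreasing A l r)), t1)" "t1 \<le> B k"
      using B(2)[OF val] by (elim computesE)
    obtain t2 where t2: "call prog 9 [enc_trm l, enc_assoc A S, enc_row (map real ?xs)] =
        Some (enc_maxplus (expand A ?xs l), t2)" "t2 \<le> C k"
      using C(2)[OF val] by (elim computesE)
    obtain t3 where t3: "call prog 9 [enc_trm r, enc_assoc A S, enc_row (map real ?xs)] =
        Some (enc_maxplus (expand A ?xs r), t3)" "t3 \<le> D k"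
      using D(2)[OF val] by (elim computesE)
    obtain t4 where t4: "call prog 16 [enc_maxplus (expand A ?xs r), enc_maxplus (expand A ?xs l)] =
        Some (DNum (of_bool (rule_decreasing A l r)), t4)"
      "t4 \<le> dominated_cost (Suc (length ?xs)) (D k) (C k)"
      using computes_dominated[OF rows_expand rows_expand D(3)[OF val] C(3)[OF val]]
      unfolding rule_decreasing_def by (elim computesE)
    show ?thesis
      using s t1 t2 t3 t4 unfolding p
      by (intro computesI) (simp_all add: rules_body_def Let_def of_bool_conj)
  qed
  moreover have "poly_bounded ?E"
    by (intro poly_bounded_intros poly_bounded_dominated_cost B C D)
  ultimately show ?case by blast
qed

lemma upt_shift: "map (\<lambda>j. i + real j) [0..<Suc n] = i # map (\<lambda>j. (i + 1) + real j) [0..<n]"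
  by (simp add: upt_conv_Cons map_Suc_upt[symmetric] del: upt_Suc)

lemma computes_iota:
  "computes 18 [enc_row r, DNum i] (enc_row (map (\<lambda>j. i + real j) [0..<length r]))
    (20 * length r + 3)"
proof (induction r arbitrary: i)
  case Nil
  show ?case by (rule computesI) (simp_all add: iota_body_def)
next
  case (Cons a r)
  let ?tail = "map (\<lambda>j. (i + 1) + real j) [0..<length r]"
  obtain t where t: "call prog 18 [enc_row r, DNum (i + 1)] = Some (enc_row ?tail, t)"
    "t \<le> 20 * length r + 3"
    using Cons[of "i + 1"] by (elim computesE)
  have "computes 18 [enc_row (a # r), DNum i] (enc_row (i # ?tail)) (20 * length (a # r) + 3)"
    using t by (intro computesI) (simp_all add: iota_body_def)
  moreover have "map (\<lambda>j. i + real j) [0..<length (a # r)] = i # ?tail"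
    using upt_shift[of i "length r"] by (simp del: upt_Suc)
  ultimately show ?case by (simp only:)
qed

lemma computes_unit_rows:
  "computes 19 [enc_row ys, enc_row xs] (enc_maxplus (unit_rows ys xs))
    (length ys * (30 * length xs + 50) + 3)"
proof (induction ys)
  case Nil
  show ?case by (rule computesI) (simp_all add: unit_rows_body_def)
next
  case (Cons y ys)
  then obtain t where "call prog 19 [enc_row ys, enc_row xs] = Some (enc_maxplus (unit_rows ys xs), t)"
    "t \<le> length ys * (30 * length xs + 50) + 3" by (elim computesE)
  moreover obtain s where "call prog 7 [enc_row xs, DNum y] = Some (enc_row (point xs y), s)"
    "s \<le> 30 * length xs + 3"
    using computes_point[of xs y] by (elim computesE)
  ultimately show ?case by (intro computesI) (simp_all add: unit_rows_body_def)
qed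

text \<open>The argument positions are named 0, ..., n - 1 so that \<open>point\<close> yields the
  unit vectors.\<close>

definition has_subterm_property :: "nat \<Rightarrow> maxplus \<Rightarrow> bool" where
  "has_subterm_property n Q \<longleftrightarrow>
     dominated (Suc n) (unit_rows (map real [0..<n]) (map real [0..<n])) Q"

lemma computes_table:
  "\<exists>B. poly_bounded B \<and> (\<forall>k A. valid_table S k A \<longrightarrow>
     computes 1 [enc_assoc A S] (DNum (of_bool (\<forall>(f, n)\<in>set S. has_subterm_property n (A f)))) (B k))"
proof (induction S)
  case Nil
  have "computes 1 [enc_assoc A []]
      (DNum (of_bool (\<forall>(f, n)\<in>set []. has_subterm_property n (A f)))) 10" for A
    by (rule computesI) (simp_all add: table_body_def)
  then show ?case by (intro exI[of _ "\<lambda>_. 10"]) (auto simp: poly_bounded_const)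
next
  case (Cons p S)
  obtain f n where p: "p = (f, n)" by (cases p)
  obtain B where B: "poly_bounded B" "\<And>k A. valid_table S k A \<Longrightarrow>
     computes 1 [enc_assoc A S] (DNum (of_bool (\<forall>(f, n)\<in>set S. has_subterm_property n (A f)))) (B k)"
    using Cons by blast
  let ?ns = "map real [0..<n]"
  \<comment> \<open>The product pays for the unit rows, and \<open>40 * n\<close> for the two
    evaluations of the list of positions.\<close>
  let ?E = "\<lambda>k. B k + dominated_cost (Suc n) n k + (n * (30 * n + 50) + 40 * n + 100)"
  have "computes 1 [enc_assoc A (p # S)]
      (DNum (of_bool (\<forall>(f, n)\<in>set (p # S). has_subterm_property n (A f)))) (?E k)"
    if val: "valid_table (p # S) k A" for k A
  proof -
    have nf: "normal_form n (A f)" "length (A f) \<le> k" and val': "valid_table S k A"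
      using val p by (auto simp: valid_table_def)
    then obtain r Q where Q: "A f = r # Q" "length r = Suc n"
      by (cases "A f") (auto simp: normal_form_def)
    then obtain a r' where r: "r = a # r'" "length r' = n" by (cases r) auto
    obtain t1 where t1: "call prog 1 [enc_assoc A S] =
        Some (DNum (of_bool (\<forall>(f, n)\<in>set S. has_subterm_property n (A f))), t1)" "t1 \<le> B k"
      using B(2)[OF val'] by (elim computesE)
    obtain t2 where t2: "call prog 18 [enc_row r', DNum 0] = Some (enc_row ?ns, t2)"
      "t2 \<le> 20 * n + 3"
      using computes_iota[of r' 0] r by (auto elim: computesE)
    obtain t3 where t3: "call prog 19 [enc_row ?ns, enc_row ?ns] =
        Some (enc_maxplus (unit_rows ?ns ?ns), t3)" "t3 \<le> n * (30 * n + 50) + 3"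
      using computes_unit_rows[of ?ns ?ns] by (auto elim: computesE)
    have "rows (Suc n) (unit_rows ?ns ?ns)" using rows_unit_rows[of ?ns ?ns] by simp
    moreover have "rows (Suc n) (r # Q)" using normal_form_rows[OF nf(1)] Q by simp
    ultimately obtain t4 where t4: "call prog 16 [enc_maxplus (unit_rows ?ns ?ns), enc_maxplus (r # Q)] =
        Some (DNum (of_bool (has_subterm_property n (A f))), t4)" "t4 \<le> dominated_cost (Suc n) n k"
      using computes_dominated[of "Suc n" "unit_rows ?ns ?ns" "r # Q" n k] nf Q
      unfolding has_subterm_property_def by (auto elim: computesE)
    show ?thesis
      using t1 t2 t3 t4 unfolding p Q r
      by (intro computesI) (simp_all add: table_body_def Let_def of_bool_conj Q r)
  qed
  moreover have "poly_bounded ?E"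
    by (intro poly_bounded_intros poly_bounded_dominated_cost B)
  ultimately show ?case by blast
qed

lemma computes_main:
  assumes "\<forall>(l, r)\<in>set (rules R). wf_term (symbols R) l \<and> wf_term (symbols R) r"
  shows "\<exists>B. poly_bounded B \<and> (\<forall>k A. valid_table (symbols R) k A \<longrightarrow>
    computes 0 [enc_input R A]
      (DNum (of_bool ((\<forall>(f, n)\<in>set (symbols R). has_subterm_property n (A f)) \<and>
        (\<forall>(l, r)\<in>set (rules R). rule_decreasing A l r)))) (B k))"
proof -
  let ?S = "symbols R"
  obtain B where B: "poly_bounded B" "\<And>k A. valid_table ?S k A \<Longrightarrow> computes 1 [enc_assoc A ?S]
      (DNum (of_bool (\<forall>(f, n)\<in>set ?S. has_subterm_property n (A f)))) (B k)"
    using computes_table[of ?S] by blast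
  obtain C where C: "poly_bounded C" "\<And>k A. valid_table ?S k A \<Longrightarrow>
      computes 17 [enc_rules (rules R), enc_assoc A ?S]
        (DNum (of_bool (\<forall>(l, r)\<in>set (rules R). rule_decreasing A l r))) (C k)"
    using computes_rules[OF assms] by blast
  have "computes 0 [enc_input R A]
      (DNum (of_bool ((\<forall>(f, n)\<in>set ?S. has_subterm_property n (A f)) \<and>
        (\<forall>(l, r)\<in>set (rules R). rule_decreasing A l r)))) (B k + C k + 30)"
    if val: "valid_table ?S k A" for k A
  proof -
    obtain t1 where t1: "call prog 1 [enc_assoc A ?S] =
        Some (DNum (of_bool (\<forall>(f, n)\<in>set ?S. has_subterm_property n (A f))), t1)" "t1 \<le> B k"
      using B(2)[OF val] by (elim computesE)
    obtain t2 where t2: "call prog 17 [enc_rules (rules R), enc_assoc A ?S] =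
        Some (DNum (of_bool (\<forall>(l, r)\<in>set (rules R). rule_decreasing A l r)), t2)" "t2 \<le> C k"
      using C(2)[OF val] by (elim computesE)
    show ?thesis
      using t1 t2
      by (intro computesI) (simp_all add: main_body_def enc_input_def enc_trs_def enc_table_def of_bool_conj)
  qed
  moreover have "poly_bounded (\<lambda>k. B k + C k + 30)" by (intro poly_bounded_intros B C)
  ultimately show ?thesis by blast
qed

section \<open>Correctness\<close>

lemma is_max_le_iff:
  "is_max P v p \<Longrightarrow> is_max Q v q \<Longrightarrow> (\<forall>r\<in>set P. \<exists>s\<in>set Q. dot r v \<le> dot s v) \<longleftrightarrow> p \<le> q"
  unfolding is_max_def by (metis order_trans)

lemma is_max_mp_eval:
  assumes "normal_form n Q" "length xs = n"
  shows "is_max Q (1 # xs) (mp_eval Q xs)"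
proof -
  have "row_eval r xs = dot r (1 # xs)" if "r \<in> set Q" for r
    using that assms by (intro row_eval_eq_dot) (auto simp: normal_form_def)
  then have "mp_eval Q xs = Max ((\<lambda>r. dot r (1 # xs)) ` set Q)"
    unfolding mp_eval_def by (metis (no_types, lifting) image_cong)
  moreover have "set Q \<noteq> {}" using assms by (auto simp: normal_form_def)
  ultimately show ?thesis
    using Max_in[of "(\<lambda>r. dot r (1 # xs)) ` set Q"] Max_ge[of "(\<lambda>r. dot r (1 # xs)) ` set Q"]
    unfolding is_max_def by fastforce
qed

lemma mp_eval_mono:
  assumes "normal_form n Q" "length xs = n" "list_all2 (\<le>) xs ys"
  shows "mp_eval Q xs \<le> mp_eval Q ys"
proof -
  have len: "length ys = n" using assms by (simp add: list_all2_lengthD[symmetric])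
  have "row_eval r xs \<le> row_eval r ys" if "r \<in> set Q" for r
  proof -
    have "length r = Suc n" "\<forall>a\<in>set r. 0 \<le> a" using that assms by (auto simp: normal_form_def)
    then show ?thesis unfolding row_eval_def using assms len
      by (auto simp: list_all2_conv_all_nth intro!: sum_mono mult_left_mono)
  qed
  moreover have "set Q \<noteq> {}" using assms by (auto simp: normal_form_def)
  ultimately show ?thesis unfolding mp_eval_def
    by (subst Max_le_iff) (auto intro: Max_ge order_trans[OF _ Max_ge])
qed

lemma has_subterm_property_iff:
  assumes "represents n Q F"
  shows "has_subterm_property n Q \<longleftrightarrow> (\<forall>xs\<in>nonneg_vecs n. \<forall>i<n. xs ! i \<le> F xs)"
proof -
  let ?ns = "map real [0..<n]"
  have nf: "normal_form n Q" and F: "\<And>xs. xs \<in> nonneg_vecs n \<Longrightarrow> F xs = mp_eval Q xs"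
    using assms by (auto simp: represents_def)
  have "has_subterm_property n Q \<longleftrightarrow> (\<forall>xs\<in>nonneg_vecs n. \<forall>r\<in>set (unit_rows ?ns ?ns).
      \<exists>q\<in>set Q. dot r (1 # xs) \<le> dot q (1 # xs))"
    unfolding has_subterm_property_def
    using rows_unit_rows[of ?ns ?ns] normal_form_rows[OF nf] by (intro dominated_iff) auto
  also have "\<dots> \<longleftrightarrow> (\<forall>xs\<in>nonneg_vecs n. \<forall>i<n. xs ! i \<le> F xs)"
  proof (intro ball_cong refl)
    fix xs assume xs: "xs \<in> nonneg_vecs n"
    then have len: "length xs = n" by (simp add: nonneg_vecs_def)
    have unit: "dot (0 # point ?ns (real i)) (1 # xs) = xs ! i" if "i < n" for i
      using dot_point[of "[0..<n]" i "(!) xs"] that len by (metis (no_types, lifting) add_0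
          atLeastLessThan_iff distinct_upt dot_simps(3) le0 map_nth mult_zero_left set_upt)
    \<comment> \<open>The value of \<open>F\<close> is an attained maximum, so being below it and
      being below some row coincide.\<close>
    have "(\<exists>q\<in>set Q. c \<le> dot q (1 # xs)) \<longleftrightarrow> c \<le> F xs" for c
      using is_max_mp_eval[OF nf len] F[OF xs] unfolding is_max_def by (metis order_trans)
    then show "(\<forall>r\<in>set (unit_rows ?ns ?ns). \<exists>q\<in>set Q. dot r (1 # xs) \<le> dot q (1 # xs)) \<longleftrightarrow>
        (\<forall>i<n. xs ! i \<le> F xs)"
      using unit by (auto simp: unit_rows_def simp del: dot_simps)
  qed
  finally show ?thesis .
qed

lemma rule_decreasing_iff:
  assumes rep: "\<And>f n. (f, n) \<in> set S \<Longrightarrow> represents n (A f) (I f)"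
    and wf: "wf_term S l" "wf_term S r" "vars r \<subseteq> vars l" "distinct (var_occs l)"
  shows "rule_decreasing A l r \<longleftrightarrow> (\<forall>v. (\<forall>x. 0 \<le> v x) \<longrightarrow> interp I v r \<le> interp I v l)"
proof -
  let ?xs = "var_occs l"
  let ?n = "length ?xs"
  let ?le = "\<lambda>ys. \<forall>p\<in>set (expand A ?xs r). \<exists>q\<in>set (expand A ?xs l). dot p (1 # ys) \<le> dot q (1 # ys)"
  have "rule_decreasing A l r \<longleftrightarrow> (\<forall>ys\<in>nonneg_vecs ?n. ?le ys)"
    unfolding rule_decreasing_def by (intro dominated_iff rows_expand)
  also have "\<dots> \<longleftrightarrow> (\<forall>v. (\<forall>x. 0 \<le> v x) \<longrightarrow> ?le (map v ?xs))"
  proof (intro iffI allI impI)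
    fix v :: "nat \<Rightarrow> real"
    assume "\<forall>ys\<in>nonneg_vecs ?n. ?le ys" "\<forall>x. 0 \<le> v x"
    moreover from this have "map v ?xs \<in> nonneg_vecs ?n" by (auto simp: nonneg_vecs_def)
    ultimately show "?le (map v ?xs)" by blast
  next
    assume le: "\<forall>v. (\<forall>x. 0 \<le> v x) \<longrightarrow> ?le (map v ?xs)"
    show "\<forall>ys\<in>nonneg_vecs ?n. ?le ys"
    proof
      fix ys assume ys: "ys \<in> nonneg_vecs ?n"
      \<comment> \<open>A vector becomes a valuation that is total: variables outside
        \<open>l\<close> get 0, which keeps it nonnegative.\<close>
      define v where "v x = (case map_of (zip ?xs ys) x of Some y \<Rightarrow> y | None \<Rightarrow> 0)" for x
      have len: "length ?xs = length ys" using ys by (simp add: nonneg_vecs_def)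
      have "0 \<le> v x" for x
        using ys by (auto simp: v_def nonneg_vecs_def split: option.splits
            dest!: map_of_SomeD set_zip_rightD)
      moreover have "map v ?xs = ys"
        using len wf(4) by (intro nth_equalityI) (auto simp: v_def map_of_zip_nth)
      ultimately show "?le ys" using le by metis
    qed
  qed
  also have "\<dots> \<longleftrightarrow> (\<forall>v. (\<forall>x. 0 \<le> v x) \<longrightarrow> interp I v r \<le> interp I v l)"
  proof -
    have "?le (map v ?xs) \<longleftrightarrow> interp I v r \<le> interp I v l" if v: "\<forall>x. 0 \<le> v x" for v
    proof -
      have "is_max (expand A ?xs t) (1 # map v ?xs) (interp I v t)"
        if "wf_term S t" "vars t \<subseteq> vars l" for t
        using rep v wf(4) that by (intro is_max_expand[where S = S]) (auto simp: vars_def)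
      then show ?thesis using wf by (intro is_max_le_iff) auto
    qed
    then show ?thesis by blast
  qed
  finally show ?thesis .
qed

lemma wf_term_mono: "wf_term S t \<Longrightarrow> set S \<subseteq> set T \<Longrightarrow> wf_term T t"
  by (induction t) auto

text \<open>The monotonicity clause is met by every represented function, which leaves exactly the
  two tests that the program performs.\<close>

lemma quasi_interpretation_iff:
  assumes R: "constructor_trs R" "left_linear R" and I: "is_assignment R I"
    and rep: "\<And>f n. (f, n) \<in> set (symbols R) \<Longrightarrow> represents n (A f) (I f)"
    and wf: "\<forall>(l, r)\<in>set (rules R). wf_term (symbols R) l \<and> wf_term (symbols R) r"
  shows "quasi_interpretation R I \<longleftrightarrow>
    (\<forall>(f, n)\<in>set (symbols R). has_subterm_property n (A f)) \<and>
    (\<forall>(l, r)\<in>set (rules R). rule_decreasing A l r)"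
proof -
  have mono: "I f xs \<le> I f ys" if "(f, n) \<in> set (symbols R)" "xs \<in> nonneg_vecs n"
    "ys \<in> nonneg_vecs n" "list_all2 (\<le>) xs ys" for f n xs ys
    using rep[OF that(1)] that mp_eval_mono[of n "A f" xs ys]
    by (auto simp: represents_def nonneg_vecs_def)
  have sub: "has_subterm_property n (A f) \<longleftrightarrow> (\<forall>xs\<in>nonneg_vecs n. \<forall>i<n. xs ! i \<le> I f xs)"
    if "(f, n) \<in> set (symbols R)" for f n
    using has_subterm_property_iff[OF rep[OF that]] .
  have dec: "rule_decreasing A l r \<longleftrightarrow> (\<forall>v. (\<forall>x. 0 \<le> v x) \<longrightarrow> interp I v r \<le> interp I v l)"
    if "(l, r) \<in> set (rules R)" for l r
    using R wf that
    by (intro rule_decreasing_iff[OF rep]) (auto simp: constructor_trs_def left_linear_def)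
  show ?thesis unfolding quasi_interpretation_def using I mono sub dec by fastforce
qed

text \<open>\<open>[:2, 1:]\<close> is 2 + Y in the second variable; its powers are the majorants
  used by \<open>poly_bounded\<close>.\<close>

lemma poly2_power: "poly2 ([:2, 1:] ^ e) x y = (y + 2) ^ e"
  by (simp add: poly2_def poly_power add.commute)

theorem theorem21:
  "\<exists>P :: program. \<forall>R :: trs. constructor_trs R \<and> orthogonal_trs R \<longrightarrow>
     (\<exists>p :: real poly poly. \<forall>(k :: nat) (d :: real) (I :: assignment) (A :: nat \<Rightarrow> maxplus).
        assignment_in_deg R k d I \<and> given_by_table R k I A \<longrightarrow>
        (\<exists>t. runs P (enc_input R A) (DNum (if quasi_interpretation R I then 1 else 0)) t \<and>
             real t \<le> poly2 p d (real k)))"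
proof (intro exI[of _ prog] allI impI)
  fix R :: trs
  assume R: "constructor_trs R \<and> orthogonal_trs R"
  have wf: "\<forall>(l, r)\<in>set (rules R). wf_term (symbols R) l \<and> wf_term (symbols R) r"
    using R by (fastforce simp: constructor_trs_def symbols_def intro: wf_term_mono)
  obtain B where B: "poly_bounded B" "\<And>k A. valid_table (symbols R) k A \<Longrightarrow>
      computes 0 [enc_input R A]
        (DNum (of_bool ((\<forall>(f, n)\<in>set (symbols R). has_subterm_property n (A f)) \<and>
          (\<forall>(l, r)\<in>set (rules R). rule_decreasing A l r)))) (B k)"
    using computes_main[OF wf] by blast
  \<comment> \<open>The exponent is obtained before \<open>k\<close>, \<open>d\<close>,
    \<open>I\<close> and \<open>A\<close> are fixed, so the polynomial depends on \<open>R\<close>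
    only.\<close>
  then obtain e where e: "\<And>k. B k \<le> (k + 2) ^ e" unfolding poly_bounded_def by blast
  have "\<exists>t. runs prog (enc_input R A) (DNum (if quasi_interpretation R I then 1 else 0)) t \<and>
      real t \<le> poly2 ([:2, 1:] ^ e) d (real k)"
    if A: "assignment_in_deg R k d I \<and> given_by_table R k I A" for k d I A
  proof -
    have val: "valid_table (symbols R) k A"
      using A by (auto simp: valid_table_def given_by_table_def represents_def max_degree_def)
    have "quasi_interpretation R I \<longleftrightarrow>
        (\<forall>(f, n)\<in>set (symbols R). has_subterm_property n (A f)) \<and>
        (\<forall>(l, r)\<in>set (rules R). rule_decreasing A l r)"
      using R A wf by (intro quasi_interpretation_iff)
        (auto simp: orthogonal_trs_def assignment_in_deg_def given_by_table_def)
    then have "computes 0 [enc_input R A] (DNum (if quasi_interpretation R I then 1 else 0)) (B k)"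
      using B(2)[OF val] by (simp add: of_bool_def)
    then obtain t where t: "call prog 0 [enc_input R A] =
        Some (DNum (if quasi_interpretation R I then 1 else 0), t)" "t \<le> B k"
      by (elim computesE)
    have "prog \<noteq> []" by (simp add: prog_def)
    then have "runs prog (enc_input R A) (DNum (if quasi_interpretation R I then 1 else 0)) t"
      using call_SomeD[OF t(1)] by (simp add: runs_def)
    moreover have "real t \<le> real ((k + 2) ^ e)" using t(2) e[of k] by linarith
    ultimately show ?thesis unfolding poly2_power by (intro exI[of _ t] conjI) (simp_all add: add.commute)
  qed
  then show "\<exists>p :: real poly poly. \<forall>k d I A.
      assignment_in_deg R k d I \<and> given_by_table R k I A \<longrightarrow>
      (\<exists>t. runs prog (enc_input R A) (DNum (if quasi_interpretation R I then 1 else 0)) t \<and>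
           real t \<le> poly2 p d (real k))" by blast
qed

end
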